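(* Let $h\ge 0$ and let $K:\mathbb{R}\to\mathbb{R}$ satisfy $K\ge 0$, $\int_{\mathbb{R}}K(s)e^{\lambda s}ds<\infty$ for all $\lambda\in\mathbb{R}$, and $\int_{\mathbb{R}}K(s)ds=1$. Let $g\in C(\mathbb{R}_+,\mathbb{R}_+)$ satisfy $g(s)>0$ for $s>0$ and suppose that for some $0<\zeta_1<\zeta_2$: 1. $g([\zeta_1,\zeta_2])\subseteq[\zeta_1,\zeta_2]$ and $g([0,\zeta_1])\subseteq[0,\zeta_2]$; 2. $\min_{s\in[\zeta_1,\zeta_2]}g(s)=g(\zeta_1)$; 3. $g(s)>s$ for $s\in(0,\zeta_1]$; 4. in $\mathbb{R}_+$ the equation $g(s)=s$ has exactly two solutions $0$ and $\kappa$. Assume $\sup_{s>0}g(s)/s<\infty$ and let $\tilde c_*:=\big(\epsilon_0(h,\sup_{s>0}g(s)/s,1)\big)^{-1/2}$, with $\epsilon_0(h,p,q)$ as defined in the context. Then the equation $$u_t(t,x)=u_{xx}(t,x)-u(t,x)+\int_{\mathbb{R}}K(x-y)g(u(t-h,y))\,dy$$ has a positive semi-wavefront $u(t,x)=\phi(x+ct)$ for every positive $c\ge\tilde c_*$.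
   Context: Definition of $\epsilon_0$: for $h\ge0$, $p>q>0$ put $$\psi(z,\epsilon)=\epsilon z^2-z-q+p\,e^{-zh}\int_{\mathbb{R}}K(s)e^{-\sqrt{\epsilon}\,zs}ds .$$ There are uniquely determined extended positive numbers $0<\epsilon_0\le\epsilon_1\le+\infty$, $\epsilon_i=\epsilon_i(h,p,q)$ (depending also on $K$), such that: for $\epsilon\in(0,\epsilon_0)$ the equation $\psi(z,\epsilon)=0$ has exactly two real roots $z$, both positive; for $\epsilon\in(\epsilon_0,\epsilon_1)$, $\psi(z,\epsilon)>0$ for all $z\in\mathbb{R}$; for $\epsilon\in(\epsilon_1,\infty)$ the equation $\psi(z,\epsilon)=0$ has exactly two real roots, both negative. Moreover $\epsilon_0=\epsilon_1$ if and only if both are $+\infty$. Convention: $(+\infty)^{-1/2}=0$. A semi-wavefront is a bounded positive classical solution of the form $u(t,x)=\phi(x+ct)$ with $\phi(-\infty)=0$. $\mathbb{R}_+=[0,\infty)$. *)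

theory Defs
  imports "HOL-Analysis.Analysis"
begin

definition psi :: "(real \<Rightarrow> real) \<Rightarrow> real \<Rightarrow> real \<Rightarrow> real \<Rightarrow> real \<Rightarrow> real \<Rightarrow> real" where
  "psi K h p q z \<epsilon> = \<epsilon> * z\<^sup>2 - z - q
     + p * exp (- z * h) * (\<integral>s. K s * exp (- sqrt \<epsilon> * z * s) \<partial>lebesgue)"

definition is_threshold_pair ::
  "(real \<Rightarrow> real) \<Rightarrow> real \<Rightarrow> real \<Rightarrow> real \<Rightarrow> ereal \<Rightarrow> ereal \<Rightarrow> bool" where
  "is_threshold_pair K h p q \<epsilon>\<^sub>0 \<epsilon>\<^sub>1 \<longleftrightarrow>
     0 < \<epsilon>\<^sub>0 \<and> \<epsilon>\<^sub>0 \<le> \<epsilon>\<^sub>1 \<and>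
     (\<forall>\<epsilon>::real. 0 < \<epsilon> \<and> ereal \<epsilon> < \<epsilon>\<^sub>0 \<longrightarrow>
        card {z. psi K h p q z \<epsilon> = 0} = 2 \<and> (\<forall>z. psi K h p q z \<epsilon> = 0 \<longrightarrow> 0 < z)) \<and>
     (\<forall>\<epsilon>::real. \<epsilon>\<^sub>0 < ereal \<epsilon> \<and> ereal \<epsilon> < \<epsilon>\<^sub>1 \<longrightarrow> (\<forall>z. 0 < psi K h p q z \<epsilon>)) \<and>
     (\<forall>\<epsilon>::real. \<epsilon>\<^sub>1 < ereal \<epsilon> \<longrightarrow>
        card {z. psi K h p q z \<epsilon> = 0} = 2 \<and> (\<forall>z. psi K h p q z \<epsilon> = 0 \<longrightarrow> z < 0)) \<and>
     (\<epsilon>\<^sub>0 = \<epsilon>\<^sub>1 \<longleftrightarrow> \<epsilon>\<^sub>0 = \<infinity> \<and> \<epsilon>\<^sub>1 = \<infinity>)"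

definition eps0 :: "(real \<Rightarrow> real) \<Rightarrow> real \<Rightarrow> real \<Rightarrow> real \<Rightarrow> ereal" where
  "eps0 K h p q = (THE \<epsilon>\<^sub>0. \<exists>\<epsilon>\<^sub>1. is_threshold_pair K h p q \<epsilon>\<^sub>0 \<epsilon>\<^sub>1)"

definition inv_sqrt_ereal :: "ereal \<Rightarrow> real" where
  "inv_sqrt_ereal e = (if e = \<infinity> then 0 else 1 / sqrt (real_of_ereal e))"

text \<open>
  Classical solutions of
  \<open>u\<^sub>t(t,x) = u\<^sub>x\<^sub>x(t,x) - u(t,x) + \<integral> K(x-y) g(u(t-h,y)) dy\<close> on the whole plane: the
  derivatives occurring in the equation exist everywhere and are jointly continuous, and
  the equation holds pointwise. Integrability is required separately because the Bochner
  integral of a non-integrable function is 0.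
\<close>

definition classical_solution ::
  "real \<Rightarrow> (real \<Rightarrow> real) \<Rightarrow> (real \<Rightarrow> real) \<Rightarrow> (real \<Rightarrow> real \<Rightarrow> real) \<Rightarrow> bool" where
  "classical_solution h K g u \<longleftrightarrow>
     (\<exists>ut ux uxx.
        (\<forall>t x. ((\<lambda>t'. u t' x) has_real_derivative ut t x) (at t)) \<and>
        (\<forall>t x. ((\<lambda>x'. u t x') has_real_derivative ux t x) (at x)) \<and>
        (\<forall>t x. ((\<lambda>x'. ux t x') has_real_derivative uxx t x) (at x)) \<and>
        continuous_on UNIV (\<lambda>(t, x). u t x) \<and>
        continuous_on UNIV (\<lambda>(t, x). ut t x) \<and>
        continuous_on UNIV (\<lambda>(t, x). ux t x) \<and>
        continuous_on UNIV (\<lambda>(t, x). uxx t x) \<and>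
        (\<forall>t x. integrable lebesgue (\<lambda>y. K (x - y) * g (u (t - h) y)) \<and>
               ut t x = uxx t x - u t x
                        + (\<integral>y. K (x - y) * g (u (t - h) y) \<partial>lebesgue)))"

definition semi_wavefront ::
  "real \<Rightarrow> (real \<Rightarrow> real) \<Rightarrow> (real \<Rightarrow> real) \<Rightarrow> real \<Rightarrow> (real \<Rightarrow> real) \<Rightarrow> bool" where
  "semi_wavefront h K g c \<phi> \<longleftrightarrow>
     bounded (range \<phi>) \<and> (\<forall>s. 0 < \<phi> s) \<and> (\<phi> \<longlongrightarrow> 0) at_bot \<and>
     classical_solution h K g (\<lambda>t x. \<phi> (x + c * t))"

end

theory Submission imports Defs "HOL-Probability.Probability" begin

text \<open>Variation of constants turns the profile equation into \<open>\<phi> = N * g(\<phi>)\<close> for a probability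
  measure \<open>N\<close>: the law of \<open>r + w + c h\<close>, with \<open>w\<close> distributed according to \<open>K\<close> and \<open>r\<close> according to
  the Green function of \<open>- \<phi>'' + c \<phi>' + \<phi>\<close>. The speed condition yields \<open>\<nu> > 0\<close> with
  \<open>p E[exp(- \<nu> x)] \<le> 1\<close>, so \<open>exp(\<nu> s)\<close> is an upper barrier. As \<open>g\<close> need not be differentiable at \<open>0\<close>
  there is no matching lower barrier, and the wave itself may decay more slowly than any exponential.
  Instead, one finds by Brouwer's theorem approximate solutions on long grids, kept above a small floor.
  Convolution with \<open>N\<close> changes an integral over an interval only by a boundary term bounded by
  \<open>B E|x|\<close>, so \<open>g(u) - u\<close> has bounded integral as long as \<open>u\<close> stays below \<open>\<delta> = \<zeta>\<^sub>1\<close>. This forces every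
  approximation to cross the level \<open>\<delta>\<close>; translating the first crossing to the origin and passing to the
  limit gives a solution, and the same bound shows that it vanishes at \<open>-\<infinity>\<close>.\<close>

text \<open>The condition on \<open>c\<close> and the moment condition on \<open>N\<close> are one
  inequality. With a b = 1 and b - a = c the Green variable has exponential moment 1 / ((a + \<nu>)
  (b - \<nu>)), and (a + \<nu>) (b - \<nu>) = 1 + c \<nu> - \<nu>^2. Hence, for 0 < \<nu> < b and q
  = 1, p E[exp(- \<nu> x)] \<le> 1 says exactly that \<open>char_fun \<nu> c \<le> 0\<close>. The
  obstacle is the zero solution, a fixed point of v -> N * g(v) that Brouwer's theorem cannot rule
  out. The floor excludes it at each stage but tends to 0; what survives in the limit is the value
  \<open>\<delta>\<close> at the origin after translation. The barrier keeps the first crossing at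
  or to the right of ln \<delta> / \<nu>, hence away from the left end of the grid. On the other
  side there is no uniform bound, so the translates lose the barrier, and the decay at -\<infinity>
  has to be proved anew for the limit. Regularity and strict positivity come from a Harnack
  inequality that \<open>N\<close> inherits from the Green function.\<close>

section \<open>Brouwer's theorem in sequence coordinates\<close>

text \<open>Tychonoff's theorem in a countable product, whose topology is metrizable, so that
  compactness is sequential. It replaces a diagonal argument both in Brouwer's theorem and in the
  passage to the limit.\<close>

lemma pointwise_convergent_subsequence:
  fixes X :: "nat \<Rightarrow> nat \<Rightarrow> real"
  assumes "\<And>k i. X k i \<in> {a..b}"
  obtains z r where "strict_mono (r :: nat \<Rightarrow> nat)" "\<And>i. z i \<in> {a..b}"
    "\<And>i. (\<lambda>k. X (r k) i) \<longlonglongrightarrow> z i"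
proof -
  have "compactin (product_topology (\<lambda>i::nat. euclidean :: real topology) UNIV) (PiE UNIV (\<lambda>i. {a..b}))"
    by (subst compactin_PiE) auto
  hence "compact (PiE (UNIV::nat set) (\<lambda>i. {a..b}))"
    by (simp add: euclidean_product_topology)
  hence "seq_compact (PiE (UNIV::nat set) (\<lambda>i. {a..b}))"
    using compact_eq_seq_compact_metric by blast
  then obtain z r where z: "z \<in> PiE UNIV (\<lambda>i. {a..b})" "strict_mono (r :: nat \<Rightarrow> nat)" "(X \<circ> r) \<longlonglongrightarrow> z"
    using assms unfolding seq_compact_def by (metis PiE_UNIV_domain UNIV_I PiE_iff extensional_UNIV)
  have "(\<lambda>k. X (r k) i) \<longlonglongrightarrow> z i" for i
    using continuous_on_tendsto_compose[OF continuous_on_product_coordinates[of i] z(3)]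
    by (simp add: o_def)
  thus thesis using z that[of r z] by (auto simp: PiE_iff)
qed

text \<open>The dimension \<open>m\<close> will be the number of grid cells, a term that varies with
  the approximation. Points of the cube are therefore coded as sequences, not as vectors of a fixed
  type, and Kuhn's combinatorial lemma is applied directly. Continuity is sequential and
  coordinatewise, the form that dominated convergence delivers.\<close>

lemma brouwer_sequence_cube:
  fixes F :: "(nat \<Rightarrow> real) \<Rightarrow> nat \<Rightarrow> real"
  assumes B: "0 < B"
    and range: "\<And>x i. (\<And>j. x j \<in> {0..B}) \<Longrightarrow> i < m \<Longrightarrow> F x i \<in> {0..B}"
    and cont: "\<And>X x i. (\<And>k j. X k j \<in> {0..B}) \<Longrightarrow> (\<And>j. x j \<in> {0..B})
        \<Longrightarrow> (\<And>j. (\<lambda>k. X k j) \<longlonglongrightarrow> x j) \<Longrightarrow> i < m \<Longrightarrow> (\<lambda>k. F (X k) i) \<longlonglongrightarrow> F x i"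
  obtains x where "\<And>j. x j \<in> {0..B}" "\<And>i. i < m \<Longrightarrow> F x i = x i"
proof -
  define sc where "sc p q = (\<lambda>j. if j < m then B * real (q j) / real (Suc p) else 0)" for p and q :: "nat \<Rightarrow> nat"
  have sc_cube: "sc p q j \<in> {0..B}" if "\<And>i. i < m \<Longrightarrow> q i \<le> Suc p" for p q j
  proof (cases "j < m")
    case True
    have "B * real (q j) \<le> B * real (Suc p)" using that[OF True] B by (intro mult_left_mono) auto
    thus ?thesis using B by (auto simp: sc_def field_simps)
  qed (use B in \<open>auto simp: sc_def\<close>)
  \<comment> \<open>Label 1 where \<open>F\<close> lowers coordinate \<open>i\<close>, label 0 where
    it does not. On the two opposite faces Kuhn's lemma prescribes the label, and there
    \<open>range\<close> makes the corresponding inequality true.\<close>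
  define lab where "lab p q i = (if q i = Suc p \<or> (q i > 0 \<and> F (sc p q) i < sc p q i) then 1 else 0 :: nat)" for p q i
  have lab_le: "sc p q i \<le> F (sc p q) i" if "\<And>i. i < m \<Longrightarrow> q i \<le> Suc p" "lab p q i = 0" "i < m" for p q i
    using that(2) range[of "sc p q" i, OF sc_cube[OF that(1)] that(3)] that(3)
    by (cases "q i = 0") (auto simp: lab_def sc_def split: if_splits)
  have lab_ge: "F (sc p q) i \<le> sc p q i" if "\<And>i. i < m \<Longrightarrow> q i \<le> Suc p" "lab p q i \<noteq> 0" "i < m" for p q i
    using that(2) range[of "sc p q" i, OF sc_cube[OF that(1)] that(3)] that(3)
    by (auto simp: lab_def sc_def split: if_splits)
  define good where "good p q \<longleftrightarrow> (\<forall>i<m. q i < Suc p) \<and> (\<forall>i<m. \<exists>u v. (\<forall>j<m. q j \<le> u j \<and> u j \<le> q j + 1) \<and>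
      (\<forall>j<m. q j \<le> v j \<and> v j \<le> q j + 1) \<and> lab p u i = 0 \<and> lab p v i \<noteq> 0)" for p and q :: "nat \<Rightarrow> nat"
  have "\<exists>q. good p q" for p
  proof -
    obtain q where q: "\<forall>i<m. q i < Suc p"
      "\<forall>i<m. \<exists>r s. (\<forall>j<m. q j \<le> r j \<and> r j \<le> q j + 1) \<and> (\<forall>j<m. q j \<le> s j \<and> s j \<le> q j + 1) \<and> lab p r i \<noteq> lab p s i"
      by (rule kuhn_lemma[of "Suc p" m "lab p"]) (auto simp: lab_def)
    show ?thesis
    proof (rule exI[of _ q], unfold good_def, intro conjI q(1) allI impI)
      fix i assume "i < m"
      then obtain r s where rs: "\<forall>j<m. q j \<le> r j \<and> r j \<le> q j + 1" "\<forall>j<m. q j \<le> s j \<and> s j \<le> q j + 1" "lab p r i \<noteq> lab p s i"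
        using q(2) by blast
      show "\<exists>u v. (\<forall>j<m. q j \<le> u j \<and> u j \<le> q j + 1) \<and>
        (\<forall>j<m. q j \<le> v j \<and> v j \<le> q j + 1) \<and> lab p u i = 0 \<and> lab p v i \<noteq> 0"
      proof (cases "lab p r i = 0")
        case True
        thus ?thesis using rs by (intro exI[of _ r] exI[of _ s]) auto
      next
        case False
        moreover have "lab p s i = 0" using False rs(3) by (auto simp: lab_def split: if_splits)
        ultimately show ?thesis using rs by (intro exI[of _ s] exI[of _ r]) auto
      qed
    qed
  qed
  hence "\<exists>q. \<forall>p. good p (q p)" by (intro choice) blast
  then obtain q where good: "\<And>p. good p (q p)" by blast
  have q: "q p i < Suc p" if "i < m" for p i using good[of p] that by (simp add: good_def)
  have ex: "\<exists>u v. (\<forall>j<m. q p j \<le> u j \<and> u j \<le> q p j + 1) \<and>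
      (\<forall>j<m. q p j \<le> v j \<and> v j \<le> q p j + 1) \<and> lab p u i = 0 \<and> lab p v i \<noteq> 0" if "i < m" for p i
    using good[of p] that by (simp add: good_def)
  define near where "near p w \<longleftrightarrow> (\<forall>j<m. q p j \<le> w j \<and> w j \<le> q p j + 1)" for p and w :: "nat \<Rightarrow> nat"
  \<comment> \<open>The two witnessing corners depend on \<open>i\<close>, but for fixed
    \<open>p\<close> all of them belong to the same small cube.\<close>
  define u where "u p i = (SOME w. near p w \<and> lab p w i = 0)" for p i
  define v where "v p i = (SOME w. near p w \<and> lab p w i \<noteq> 0)" for p i
  have u': "near p (u p i) \<and> lab p (u p i) i = 0" if "i < m" for p i
    unfolding u_def using ex[OF that, of p] by (intro someI_ex[where P = "\<lambda>w. near p w \<and> lab p w i = 0"]) (auto simp: near_def)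
  have v': "near p (v p i) \<and> lab p (v p i) i \<noteq> 0" if "i < m" for p i
    unfolding v_def using ex[OF that, of p] by (intro someI_ex[where P = "\<lambda>w. near p w \<and> lab p w i \<noteq> 0"]) (unfold near_def, blast)
  have u: "q p j \<le> u p i j \<and> u p i j \<le> q p j + 1" if "i < m" "j < m" for p i j
    using u'[OF that(1)] that(2) by (auto simp: near_def)
  have v: "q p j \<le> v p i j \<and> v p i j \<le> q p j + 1" if "i < m" "j < m" for p i j
    using v'[OF that(1)] that(2) by (auto simp: near_def)
  have lu: "lab p (u p i) i = 0" and lv: "lab p (v p i) i \<noteq> 0" if "i < m" for p i
    using u'[OF that] v'[OF that] by auto
  define X where "X p = sc p (q p)" for p
  have X: "X p j \<in> {0..B}" for p j
    unfolding X_def by (rule sc_cube) (use q in \<open>simp add: less_imp_le\<close>)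
  obtain z r where r: "strict_mono (r :: nat \<Rightarrow> nat)" and z: "\<And>i. z i \<in> {0..B}"
    and lim: "\<And>i. (\<lambda>k. X (r k) i) \<longlonglongrightarrow> z i"
    using pointwise_convergent_subsequence[of X 0 B, OF X] by metis
  \<comment> \<open>Each coordinate of a corner differs from that of \<open>X p\<close> by at most
    one mesh width B / (p + 1). All corners therefore share the limit \<open>z\<close>, and the
    inequalities recorded by the labels pass to the limit in both directions.\<close>
  have lim_near: "(\<lambda>k. sc (r k) (w (r k)) j) \<longlonglongrightarrow> z j"
    if w: "\<And>p j. j < m \<Longrightarrow> q p j \<le> w p j \<and> w p j \<le> q p j + 1" for w :: "nat \<Rightarrow> nat \<Rightarrow> nat" and j
  proof -
    have "norm (sc (r k) (w (r k)) j - X (r k) j) \<le> B * inverse (real (Suc k))" for k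
    proof (cases "j < m")
      case True
      have 1: "sc (r k) (w (r k)) j - X (r k) j = B * ((real (w (r k) j) - real (q (r k) j)) / real (Suc (r k)))"
        using True by (simp add: sc_def X_def diff_divide_distrib right_diff_distrib)
      have 2: "\<bar>real (w (r k) j) - real (q (r k) j)\<bar> \<le> 1"
        using w[OF True, of "r k"] by linarith
      have "\<bar>(real (w (r k) j) - real (q (r k) j)) / real (Suc (r k))\<bar> \<le> 1 / real (Suc (r k))"
        unfolding abs_divide by (rule frac_le) (use 2 in auto)
      also have "\<dots> \<le> inverse (real (Suc k))"
        using seq_suble[OF r, of k] by (simp add: inverse_eq_divide frac_le)
      finally have "B * \<bar>(real (w (r k) j) - real (q (r k) j)) / real (Suc (r k))\<bar> \<le> B * inverse (real (Suc k))"
        using B by (intro mult_left_mono) auto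
      thus ?thesis unfolding 1 real_norm_def abs_mult using B by simp
    qed (use B in \<open>simp add: sc_def X_def\<close>)
    moreover have "(\<lambda>k. B * inverse (real (Suc k))) \<longlonglongrightarrow> 0"
      using tendsto_mult[OF tendsto_const LIMSEQ_inverse_real_of_nat, of B] by simp
    ultimately have "(\<lambda>k. sc (r k) (w (r k)) j - X (r k) j) \<longlonglongrightarrow> 0"
      by (rule Lim_null_comparison[OF always_eventually[OF allI]])
    from tendsto_add[OF this lim[of j]] show ?thesis by simp
  qed
  have "F z i = z i" if i: "i < m" for i
  proof -
    have uc: "u p i j \<le> Suc p" "v p i j \<le> Suc p" if "j < m" for p j
      using u[OF i that, of p] v[OF i that, of p] q[OF that, of p] by linarith+
    show ?thesis
    proof (rule antisym)
    have l1: "(\<lambda>k. F (sc (r k) (u (r k) i)) i) \<longlonglongrightarrow> F z i"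
      by (rule cont[OF sc_cube z lim_near i]) (use uc(1) u[OF i] in blast)+
    have l2: "(\<lambda>k. sc (r k) (u (r k) i) i) \<longlonglongrightarrow> z i"
      by (rule lim_near) (use u[OF i] in blast)
    have "sc (r k) (u (r k) i) i \<le> F (sc (r k) (u (r k) i)) i" for k
      by (rule lab_le[OF uc(1)]) (use lu[OF i] i in auto)
    thus "z i \<le> F z i" by (intro LIMSEQ_le[OF l2 l1]) blast
  next
    have l1: "(\<lambda>k. F (sc (r k) (v (r k) i)) i) \<longlonglongrightarrow> F z i"
      by (rule cont[OF sc_cube z lim_near i]) (use uc(2) v[OF i] in blast)+
    have l2: "(\<lambda>k. sc (r k) (v (r k) i) i) \<longlonglongrightarrow> z i"
      by (rule lim_near) (use v[OF i] in blast)
    have "F (sc (r k) (v (r k) i)) i \<le> sc (r k) (v (r k) i) i" for k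
      by (rule lab_ge[OF uc(2)]) (use lv[OF i] i in auto)
    thus "F z i \<le> z i" by (intro LIMSEQ_le[OF l1 l2]) blast
    qed
  qed
  thus thesis using z that by blast
qed

section \<open>Convolution with a probability measure\<close>

lemma set_integrable_bounded_Icc:
  fixes v :: "real \<Rightarrow> real"
  assumes [measurable]: "v \<in> borel_measurable borel" and "\<And>x. \<bar>v x\<bar> \<le> B"
  shows "set_integrable lborel {a..b} v"
  unfolding set_integrable_def
  by (rule integrableI_bounded_set[where A="{a..b}" and B=B])
     (use assms(2) emeasure_compact_finite[of "{a..b}"] in \<open>auto simp: less_top indicator_def\<close>)

text \<open>Translation by \<open>x\<close> shifts the window, which thereby loses at most the
  interval \<open>J\<close> of length |x|, where \<open>v\<close> is at most
  \<open>B\<close>.\<close>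

lemma set_integral_translate_ge:
  fixes v :: "real \<Rightarrow> real"
  assumes [measurable]: "v \<in> borel_measurable borel" and v: "\<And>x. 0 \<le> v x" "\<And>x. v x \<le> B"
  shows "(LINT t:{a..b}|lborel. v t) - B * \<bar>x\<bar> \<le> (LINT t:{a..b}|lborel. v (t - x))"
proof -
  have B: "\<bar>v x\<bar> \<le> B" for x using v[of x] by auto
  define J where "J = (if 0 \<le> x then {b - x..b} else {a..a - x})"
  have J: "measure lborel J = \<bar>x\<bar>" "emeasure lborel J < \<infinity>" "J \<in> sets borel"
    by (auto simp: J_def)
  have shift: "(\<lambda>y. indicator {a..b} (x + 1 * y) * v (x + 1 * y - x)) = (\<lambda>y. indicator {a-x..b-x} y * v y)"
    by (intro ext) (auto simp: indicator_def algebra_simps)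
  have eq: "(LINT t:{a..b}|lborel. v (t - x)) = (LINT t:{a-x..b-x}|lborel. v t)"
    unfolding set_lebesgue_integral_def
    using lborel_integral_real_affine[of 1 "\<lambda>t. indicator {a..b} t * v (t - x)" x] shift by simp
  have i1: "integrable lborel (\<lambda>t. indicator {a-x..b-x} t *\<^sub>R v t)" "integrable lborel (\<lambda>t. indicator {a..b} t *\<^sub>R v t)"
    using set_integrable_bounded_Icc[OF assms(1) B] by (auto simp: set_integrable_def)
  have "(LINT t:{a..b}|lborel. v t) \<le> (\<integral>t. indicator {a-x..b-x} t *\<^sub>R v t + B * indicator J t \<partial>lborel)"
    unfolding set_lebesgue_integral_def
  proof (rule integral_mono)
    show "integrable lborel (\<lambda>t. indicator {a - x..b - x} t *\<^sub>R v t + B * indicator J t)"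
      using i1 J by (intro Bochner_Integration.integrable_add integrable_mult_right) auto
    show "indicator {a..b} t *\<^sub>R v t \<le> indicator {a - x..b - x} t *\<^sub>R v t + B * indicator J t" for t
      using v[of t] by (auto simp: J_def indicator_def)
  qed (use i1 in auto)
  also have "\<dots> = (LINT t:{a-x..b-x}|lborel. v t) + B * \<bar>x\<bar>"
    unfolding set_lebesgue_integral_def using i1 J
    by (subst Bochner_Integration.integral_add) (auto intro!: integrable_mult_right)
  finally show ?thesis unfolding eq by simp
qed

text \<open>\<open>harnack\<close> is stated for the convolution and not for a density. It is the
  source of the Lipschitz bound, of the measurability of convolutions and of the positivity of the
  wave.\<close>

locale wave_kernel = prob_space N for N :: "real measure" +
  fixes C :: real
  assumes sets_N [measurable_cong]: "sets N = sets borel"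
    and C_nonneg: "0 \<le> C"
    and first_moment: "integrable N (\<lambda>x. x)"
    and harnack: "\<And>v B s t. v \<in> borel_measurable borel \<Longrightarrow> (\<And>x. 0 \<le> v x) \<Longrightarrow> (\<And>x. v x \<le> B) \<Longrightarrow>
       exp (- C * \<bar>t - s\<bar>) * (\<integral>x. v (t - x) \<partial>N) \<le> (\<integral>x. v (s - x) \<partial>N)"
begin

definition conv :: "(real \<Rightarrow> real) \<Rightarrow> real \<Rightarrow> real" where
  "conv v t = (\<integral>x. v (t - x) \<partial>N)"

lemma integrable_translate:
  assumes "v \<in> borel_measurable borel" "\<And>x. \<bar>v x\<bar> \<le> B"
  shows "integrable N (\<lambda>x. v (t - x) :: real)"
proof (rule integrable_const_bound[where B=B])
  show "AE x in N. norm (v (t - x)) \<le> B" using assms(2) by auto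
  show "(\<lambda>x. v (t - x)) \<in> borel_measurable N" using assms(1) by measurable
qed

lemma conv_range:
  assumes "v \<in> borel_measurable borel" "\<And>x. 0 \<le> v x" "\<And>x. v x \<le> B"
  shows "0 \<le> conv v t" "conv v t \<le> B"
proof -
  have "\<bar>v x\<bar> \<le> B" for x using assms(2,3)[of x] by auto
  from integrable_translate[OF assms(1) this, of t] assms
  show "0 \<le> conv v t" "conv v t \<le> B"
    unfolding conv_def by (auto intro!: integral_nonneg integral_le_const)
qed

text \<open>Since 1 - C |t - s| \<le> exp(- C |t - s|), the Harnack inequality bounds the difference
  from one side; exchanging \<open>s\<close> and \<open>t\<close> gives the other.\<close>

lemma conv_lipschitz:
  assumes "v \<in> borel_measurable borel" "\<And>x. 0 \<le> v x" "\<And>x. v x \<le> B"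
  shows "\<bar>conv v t - conv v s\<bar> \<le> C * B * \<bar>t - s\<bar>"
proof -
  have half: "conv v t - conv v s \<le> C * B * \<bar>t - s\<bar>" for s t
  proof -
    have "1 - C * \<bar>t - s\<bar> \<le> exp (- C * \<bar>t - s\<bar>)"
      using exp_ge_add_one_self[of "- C * \<bar>t - s\<bar>"] by simp
    hence "(1 - C * \<bar>t - s\<bar>) * conv v t \<le> exp (- C * \<bar>t - s\<bar>) * conv v t"
      by (rule mult_right_mono) (rule conv_range(1)[OF assms])
    also have "\<dots> \<le> conv v s" unfolding conv_def by (rule harnack[OF assms])
    finally have "conv v t - conv v s \<le> C * \<bar>t - s\<bar> * conv v t" by (simp add: algebra_simps)
    also have "\<dots> \<le> C * \<bar>t - s\<bar> * B"
      using C_nonneg conv_range(2)[OF assms] by (intro mult_left_mono) auto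
    finally show ?thesis by (simp add: mult_ac)
  qed
  show ?thesis using half[of t s] half[of s t] by (simp add: abs_le_iff abs_minus_commute)
qed

lemma lipschitz_continuous:
  fixes f :: "real \<Rightarrow> real"
  assumes "\<And>s t. \<bar>f t - f s\<bar> \<le> D * \<bar>t - s\<bar>"
  shows "continuous_on UNIV f"
proof -
  have D: "0 \<le> D" using assms[of 1 0] by auto
  have "D-lipschitz_on UNIV f"
    by (rule lipschitz_onI) (use assms D in \<open>auto simp: dist_real_def\<close>)
  thus ?thesis by (rule lipschitz_on_continuous_on)
qed

lemma conv_measurable:
  assumes "v \<in> borel_measurable borel" "\<And>x. 0 \<le> v x" "\<And>x. v x \<le> B"
  shows "conv v \<in> borel_measurable borel"
  by (rule borel_measurable_continuous_onI, rule lipschitz_continuous, rule conv_lipschitz[OF assms])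

text \<open>By Fubini the integral on the right is an average over \<open>x\<close> of integrals of
  translates, and each translate loses at most B |x|. The point is that the loss does not depend on
  the length of the interval.\<close>

lemma set_integral_conv_ge:
  assumes v: "v \<in> borel_measurable borel" "\<And>x. 0 \<le> v x" "\<And>x. v x \<le> B"
  shows "(LINT t:{a..b}|lborel. v t) - B * expectation (\<lambda>x. \<bar>x\<bar>) \<le> (LINT t:{a..b}|lborel. conv v t)"
proof -
  \<comment> \<open>Lebesgue measure on the interval is finite, so the bounded integrand is
    integrable on the product and Fubini applies.\<close>
  define M where "M = restrict_space lborel {a..b}"
  have fM: "finite_measure M"
    by (rule finite_measureI) (use emeasure_compact_finite[of "{a..b}"] in \<open>auto simp: M_def emeasure_restrict_space space_restrict_space less_top\<close>)
  interpret M: finite_measure M by (rule fM)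
  interpret P: pair_sigma_finite M N ..
  have vB: "\<bar>v x\<bar> \<le> B" for x using v(2,3)[of x] by auto
  note [measurable] = v(1)
  have id: "(\<lambda>x. x) \<in> M \<rightarrow>\<^sub>M borel" unfolding M_def by (rule measurable_restrict_space1) auto
  have fst_M: "fst \<in> M \<Otimes>\<^sub>M N \<rightarrow>\<^sub>M borel" by (rule measurable_compose[OF measurable_fst id])
  have meas: "(\<lambda>z. v (fst z - snd z)) \<in> borel_measurable (M \<Otimes>\<^sub>M N)"
    using fst_M by measurable
  have fin: "finite_measure (M \<Otimes>\<^sub>M N)"
    using finite_measure_axioms fM by (rule finite_measure_pair_measure)
  have int: "integrable (M \<Otimes>\<^sub>M N) (\<lambda>z. v (fst z - snd z))"
    using vB meas by (intro finite_measure.integrable_const_bound[OF fin, where B=B]) auto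
  have M_eq: "(\<integral>t. w t \<partial>M) = (LINT t:{a..b}|lborel. w t)" for w :: "real \<Rightarrow> real"
    unfolding M_def set_lebesgue_integral_def by (subst integral_restrict_space) auto
  have fub: "(\<integral>t. conv v t \<partial>M) = (\<integral>x. (\<integral>t. v (t - x) \<partial>M) \<partial>N)"
    unfolding conv_def using P.Fubini_integral[of "\<lambda>t x. v (t - x)"] int by (simp add: case_prod_beta')
  have "(LINT t:{a..b}|lborel. v t) - B * expectation (\<lambda>x. \<bar>x\<bar>) = (\<integral>x. (LINT t:{a..b}|lborel. v t) - B * \<bar>x\<bar> \<partial>N)"
    using integrable_abs[OF first_moment] prob_space by (subst Bochner_Integration.integral_diff) auto
  also have "\<dots> \<le> (\<integral>x. (\<integral>t. v (t - x) \<partial>M) \<partial>N)"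
  proof (rule integral_mono)
    show "integrable N (\<lambda>x. (LINT t:{a..b}|lborel. v t) - B * \<bar>x\<bar>)"
      using integrable_abs[OF first_moment] by auto
    show "integrable N (\<lambda>x. \<integral>t. v (t - x) \<partial>M)"
      using P.integrable_snd[of "\<lambda>t x. v (t - x)"] int by (simp add: case_prod_beta')
    show "(LINT t:{a..b}|lborel. v t) - B * \<bar>x\<bar> \<le> (\<integral>t. v (t - x) \<partial>M)" for x
      unfolding M_eq by (rule set_integral_translate_ge[OF v])
  qed
  finally show ?thesis unfolding fub[symmetric] unfolding M_eq[of "conv v"] .
qed

end

section \<open>Approximate solutions\<close>

text \<open>\<open>g\<close> stands for the nonlinearity after truncation and extension to the line,
  so that it can be composed with any function. \<open>g_le\<close> and \<open>exp_moment\<close>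
  together make exp(\<nu> s) a supersolution.\<close>

locale wave_equation = wave_kernel +
  fixes g :: "real \<Rightarrow> real" and p B \<delta> \<nu> :: real
  assumes g_cont: "continuous_on UNIV g"
    and g_nonneg: "\<And>s. 0 \<le> g s" and g_le_B: "\<And>s. g s \<le> B"
    and g_le: "\<And>s. 0 \<le> s \<Longrightarrow> g s \<le> p * s"
    and g_gt: "\<And>s. 0 < s \<Longrightarrow> s \<le> \<delta> \<Longrightarrow> s < g s"
    and \<delta>_pos: "0 < \<delta>" and \<nu>_pos: "0 < \<nu>"
    and exp_integrable: "integrable N (\<lambda>x. exp (- \<nu> * x))"
    and exp_moment: "p * expectation (\<lambda>x. exp (- \<nu> * x)) \<le> 1"
begin

lemma g_0 [simp]: "g 0 = 0"
  using g_nonneg[of 0] g_le[of 0] by simp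

lemma \<delta>_less_B: "\<delta> < B"
  using g_gt[of \<delta>] g_le_B[of \<delta>] \<delta>_pos by simp

lemma B_pos: "0 < B" using \<delta>_less_B \<delta>_pos by simp

lemma p_pos: "0 < p"
proof -
  have "0 < p * \<delta>" using g_gt[of \<delta>] g_le[of \<delta>] \<delta>_pos by simp
  thus ?thesis using \<delta>_pos by (simp add: zero_less_mult_iff)
qed

lemma g_measurable [measurable]: "g \<in> borel_measurable borel"
  by (rule borel_measurable_continuous_onI[OF g_cont])

lemma compose_g:
  assumes [measurable]: "v \<in> borel_measurable borel"
  shows "(\<lambda>s. g (v s)) \<in> borel_measurable borel" "\<And>s. 0 \<le> g (v s)" "\<And>s. g (v s) \<le> B"
  using g_nonneg g_le_B by auto

lemma isCont_g: "isCont g x"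
  using g_cont by (simp add: continuous_on_eq_continuous_at)

lemma conv_le_exp:
  assumes v: "v \<in> borel_measurable borel" "\<And>s. 0 \<le> v s" "\<And>s. v s \<le> exp (\<nu> * s)"
  shows "conv (\<lambda>s. g (v s)) t \<le> exp (\<nu> * t)"
proof -
  note cg = compose_g[OF v(1)]
  have "conv (\<lambda>s. g (v s)) t \<le> (\<integral>x. (p * exp (\<nu> * t)) * exp (- \<nu> * x) \<partial>N)"
    unfolding conv_def
  proof (rule integral_mono)
    show "integrable N (\<lambda>x. g (v (t - x)))"
      by (rule integrable_translate[of "\<lambda>s. g (v s)" B, OF cg(1)]) (use cg in auto)
    show "integrable N (\<lambda>x. (p * exp (\<nu> * t)) * exp (- \<nu> * x))"
      by (intro integrable_mult_right exp_integrable)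
    show "g (v (t - x)) \<le> (p * exp (\<nu> * t)) * exp (- \<nu> * x)" for x
    proof -
      have "g (v (t - x)) \<le> p * v (t - x)" by (rule g_le[OF v(2)])
      also have "\<dots> \<le> p * exp (\<nu> * (t - x))" using p_pos v(3) by (intro mult_left_mono) auto
      finally show ?thesis by (simp add: mult_exp_exp algebra_simps)
    qed
  qed
  also have "\<dots> = exp (\<nu> * t) * (p * expectation (\<lambda>x. exp (- \<nu> * x)))"
    using exp_integrable by simp
  also have "\<dots> \<le> exp (\<nu> * t)"
    using mult_left_mono[OF exp_moment, of "exp (\<nu> * t)"] by simp
  finally show ?thesis .
qed

text \<open>\<open>g\<close> is dominated by the constant \<open>B\<close>, integrable for a
  probability measure. Pointwise convergence is thus enough, for the continuity required in
  Brouwer's theorem as well as for the final limit.\<close>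

lemma conv_g_tendsto:
  fixes V :: "nat \<Rightarrow> real \<Rightarrow> real"
  assumes [measurable]: "\<And>k. V k \<in> borel_measurable borel" "v \<in> borel_measurable borel"
    and lim: "\<And>s. (\<lambda>k. V k s) \<longlonglongrightarrow> v s"
  shows "(\<lambda>k. conv (\<lambda>s. g (V k s)) t) \<longlonglongrightarrow> conv (\<lambda>s. g (v s)) t"
  unfolding conv_def
proof (rule integral_dominated_convergence[where w="\<lambda>_. B"])
  show "AE x in N. (\<lambda>k. g (V k (t - x))) \<longlonglongrightarrow> g (v (t - x))"
    using isCont_tendsto_compose[OF isCont_g lim] by auto
qed (use g_nonneg g_le_B in \<open>auto simp: abs_of_nonneg\<close>)

text \<open>The exponential barrier survives discretisation because a step function takes its value
  from the left endpoint of each cell. The floor \<open>\<theta>\<close> keeps the fixed point away from zero.\<close>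

lemma approximate_solution:
  fixes L n :: nat
  assumes \<theta>: "0 < \<theta>" "\<theta> \<le> 1" "\<theta> \<le> B" and n: "0 < n"
  obtains U where "U \<in> borel_measurable borel" "\<And>s. 0 \<le> U s" "\<And>s. U s \<le> B" "\<And>s. U s \<le> exp (\<nu> * s)"
    "\<And>s. - real L \<le> s \<Longrightarrow> s < real L \<Longrightarrow> \<bar>U s - conv (\<lambda>s. g (U s)) s\<bar> \<le> \<theta> + C * B / n"
    "\<And>s. - real L \<le> s \<Longrightarrow> s < real L \<Longrightarrow> conv (\<lambda>s. g (U s)) s - C * B / n \<le> U s"
    "\<And>s. 0 \<le> s \<Longrightarrow> s < real L \<Longrightarrow> \<theta> \<le> U s"
proof -
  \<comment> \<open>The window [-L, L) is cut into \<open>m\<close> cells of width 1 / n; outside it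
    the step function \<open>E x\<close> is 0.\<close>
  define m where "m = 2 * L * n"
  define grid where "grid i = real i / n - L" for i :: nat
  define idx where "idx s = nat \<lfloor>(s + L) * n\<rfloor>" for s :: real
  define E where "E x s = (if s \<in> {- real L..<L} then x (idx s) else 0)" for x :: "nat \<Rightarrow> real" and s
  \<comment> \<open>The cap by the barrier is applied last, so the floor is fully in force only
    where exp(\<nu> s) \<ge> \<theta>; this includes [0, L) because \<theta> \<le> 1.\<close>
  define F where "F x i = min (exp (\<nu> * grid i)) (max \<theta> (conv (\<lambda>s. g (E x s)) (grid i)))" for x i
  have grid_idx: "idx s < m" "grid (idx s) \<le> s" "s < grid (idx s) + 1 / n" if "- real L \<le> s" "s < real L" for s :: real
  proof -
    have nn: "0 \<le> (s + L) * n" using that by simp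
    have f: "real (idx s) \<le> (s + L) * n" "(s + L) * n < real (idx s) + 1"
      unfolding idx_def using nn by linarith+
    have "(s + L) * n < (2 * real L) * n" using that n by (intro mult_strict_right_mono) auto
    hence "real (idx s) < real m" using f(1) by (simp add: m_def)
    thus "idx s < m" by simp
    show "grid (idx s) \<le> s" "s < grid (idx s) + 1 / n"
      using f n by (simp_all add: grid_def field_simps)
  qed
  have E_meas [measurable]: "E x \<in> borel_measurable borel" for x
  proof -
    have "(\<lambda>s. (s + real L) * real n) \<in> borel_measurable borel" by measurable
    hence "(\<lambda>s. \<lfloor>(s + real L) * real n\<rfloor>) \<in> borel \<rightarrow>\<^sub>M count_space UNIV"
      by measurable
    hence "(\<lambda>s. x (idx s)) \<in> borel_measurable borel"
      unfolding idx_def by (rule measurable_compose) auto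
    thus ?thesis unfolding E_def by measurable
  qed
  have "F x i \<in> {0..B}" if "\<And>j. x j \<in> {0..B}" for x i
    using conv_range[OF compose_g[OF E_meas[of x]], of "grid i"] \<theta> by (auto simp: F_def min_def)
  moreover have "(\<lambda>k. F (X k) i) \<longlonglongrightarrow> F x i" if "\<And>j. (\<lambda>k. X k j) \<longlonglongrightarrow> x j" for X x i
    unfolding F_def
    by (intro tendsto_min tendsto_max tendsto_const conv_g_tendsto E_meas) (use that in \<open>auto simp: E_def\<close>)
  ultimately obtain x where x: "\<And>j. x j \<in> {0..B}" and fp: "\<And>i. i < m \<Longrightarrow> F x i = x i"
    using brouwer_sequence_cube[of B m F] B_pos by metis
  define T where "T = conv (\<lambda>s. g (E x s))"
  have T: "0 \<le> T s" "T s \<le> B" "\<bar>T s - T t\<bar> \<le> C * B * \<bar>s - t\<bar>" for s t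
    unfolding T_def using conv_range[OF compose_g[OF E_meas[of x]]] conv_lipschitz[OF compose_g[OF E_meas[of x]]] by auto
  have E0: "0 \<le> E x s" "E x s \<le> B" for s using x[of "idx s"] B_pos by (auto simp: E_def)
  have E_exp: "E x s \<le> exp (\<nu> * s)" for s
  proof (cases "s \<in> {- real L..<L}")
    case True
    hence g: "idx s < m" "grid (idx s) \<le> s" using grid_idx[of s] by auto
    have "x (idx s) \<le> exp (\<nu> * grid (idx s))" unfolding fp[OF g(1), symmetric] by (simp add: F_def)
    also have "\<dots> \<le> exp (\<nu> * s)" using g(2) \<nu>_pos by simp
    finally show ?thesis using True by (simp add: E_def)
  qed (auto simp: E_def)
  have T_exp: "T s \<le> exp (\<nu> * s)" for s
    unfolding T_def by (rule conv_le_exp) (use E0 E_exp in auto)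
  \<comment> \<open>As \<open>T\<close> lies below the barrier, the cap can cut off only what the
    floor has added. The fixed point therefore lies between \<open>T\<close> and T + \<theta> at the
    grid points.\<close>
  have fp': "T (grid i) \<le> x i" "x i \<le> T (grid i) + \<theta>" "min (exp (\<nu> * grid i)) \<theta> \<le> x i" if "i < m" for i
    using fp[OF that] T_exp[of "grid i"] T(1)[of "grid i"] \<theta> unfolding F_def T_def[symmetric] by auto
  have near: "\<bar>T (grid (idx s)) - T s\<bar> \<le> C * B / n" if "- real L \<le> s" "s < real L" for s :: real
  proof -
    have "\<bar>T (grid (idx s)) - T s\<bar> \<le> C * B * \<bar>grid (idx s) - s\<bar>" by (rule T(3))
    also have "\<dots> \<le> C * B * (1 / n)"
      using grid_idx[OF that] C_nonneg B_pos by (intro mult_left_mono) auto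
    finally show ?thesis by simp
  qed
  show thesis
  proof (rule that[of "E x"])
    fix s assume s: "- real L \<le> s" "s < real L"
    have e: "E x s = x (idx s)" using s by (simp add: E_def)
    show "\<bar>E x s - conv (\<lambda>s. g (E x s)) s\<bar> \<le> \<theta> + C * B / n"
      "conv (\<lambda>s. g (E x s)) s - C * B / n \<le> E x s"
      using fp'[OF grid_idx(1)[OF s]] near[OF s] unfolding T_def[symmetric] e by linarith+
  next
    fix s assume s: "0 \<le> s" "s < real L"
    have s': "- real L \<le> s" using s by simp
    have e: "E x s = x (idx s)" using s by (simp add: E_def)
    have "real (L * n) \<le> (s + L) * n" using s by (simp add: algebra_simps)
    hence "L * n \<le> idx s" unfolding idx_def by linarith
    hence "real (L * n) \<le> real (idx s)" by (simp only: of_nat_le_iff)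
    hence "0 \<le> grid (idx s)" using n by (simp add: grid_def field_simps)
    hence "1 \<le> exp (\<nu> * grid (idx s))" using \<nu>_pos by simp
    thus "\<theta> \<le> E x s" using fp'(3)[OF grid_idx(1)[OF s' s(2)]] \<theta> unfolding e by linarith
  qed (use E0 E_exp E_meas in auto)
qed

section \<open>Integral bounds that force the level \<delta> to be reached\<close>

lemma g_gap:
  assumes "0 < \<theta>" "\<theta> \<le> \<delta>"
  obtains \<mu> where "0 < \<mu>" "\<And>u. \<theta> \<le> u \<Longrightarrow> u \<le> \<delta> \<Longrightarrow> u + \<mu> \<le> g u"
proof -
  have "continuous_on {\<theta>..\<delta>} (\<lambda>u. g u - u)"
    by (intro continuous_intros continuous_on_subset[OF g_cont]) auto
  then obtain w where w: "w \<in> {\<theta>..\<delta>}" "\<And>u. u \<in> {\<theta>..\<delta>} \<Longrightarrow> g w - w \<le> g u - u"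
    using continuous_attains_inf[of "{\<theta>..\<delta>}" "\<lambda>u. g u - u"] assms by auto
  show thesis
  proof (rule that[of "g w - w"])
    show "0 < g w - w" using g_gt[of w] w(1) assms by simp
    show "u + (g w - w) \<le> g u" if "\<theta> \<le> u" "u \<le> \<delta>" for u using w(2)[of u] that by simp
  qed
qed

text \<open>The integral of the convolution is at least that of \<open>g (U s)\<close> minus B E|x|,
  and by \<open>ge\<close> at most that of \<open>U\<close> plus \<epsilon> (b - a). The last term
  is the only one that grows with the interval, and the mesh will keep it small.\<close>

lemma set_integral_gap_le:
  assumes U: "U \<in> borel_measurable borel" "\<And>s. 0 \<le> U s" "\<And>s. U s \<le> B"
    and ab: "a \<le> b"
    and ge: "\<And>s. s \<in> {a..b} \<Longrightarrow> conv (\<lambda>s. g (U s)) s - \<epsilon> \<le> U s"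
  shows "(LINT s:{a..b}|lborel. g (U s) - U s) \<le> B * expectation (\<lambda>x. \<bar>x\<bar>) + \<epsilon> * (b - a)"
proof -
  note cg = compose_g[OF U(1)]
  have i: "set_integrable lborel {a..b} U" "set_integrable lborel {a..b} (\<lambda>s. g (U s))"
    "set_integrable lborel {a..b} (conv (\<lambda>s. g (U s)))" "set_integrable lborel {a..b} (\<lambda>s. \<epsilon>)"
    using U cg conv_measurable[OF cg] conv_range[OF cg] set_integrable_bounded_Icc[of "\<lambda>_. \<epsilon>" "\<bar>\<epsilon>\<bar>"]
    by (auto intro!: set_integrable_bounded_Icc[where B=B])
  have "(LINT s:{a..b}|lborel. conv (\<lambda>s. g (U s)) s - \<epsilon>) \<le> (LINT s:{a..b}|lborel. U s)"
    using i ge by (intro set_integral_mono set_integral_diff) auto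
  moreover have "(LINT s:{a..b}|lborel. \<epsilon>) = \<epsilon> * (b - a)" using ab
    by (simp add: set_lebesgue_integral_def)
  ultimately show ?thesis
    using set_integral_conv_ge[OF cg, of a b] i by (simp add: set_integral_diff)
qed

text \<open>If \<open>U\<close> stayed below \<delta>, the gap g(U) - U would be nonnegative on the
  whole window and at least \<mu> on [0, R], where the floor holds. Its integral would be at least R
  \<mu>, more than \<open>set_integral_gap_le\<close> allows.\<close>

lemma crossing:
  assumes U: "U \<in> borel_measurable borel" "\<And>s. 0 \<le> U s" "\<And>s. U s \<le> B"
    and LR: "0 \<le> L" "0 \<le> R"
    and ge: "\<And>s. s \<in> {-L..R} \<Longrightarrow> conv (\<lambda>s. g (U s)) s - \<epsilon> \<le> U s"
    and \<theta>: "\<And>s. s \<in> {0..R} \<Longrightarrow> \<theta> \<le> U s"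
    and \<mu>: "\<And>u. \<theta> \<le> u \<Longrightarrow> u \<le> \<delta> \<Longrightarrow> u + \<mu> \<le> g u"
    and R: "B * expectation (\<lambda>x. \<bar>x\<bar>) + \<epsilon> * (R + L) < R * \<mu>"
  shows "\<exists>s\<in>{-L..R}. \<delta> \<le> U s"
proof (rule ccontr)
  assume "\<not> ?thesis"
  hence less: "U s < \<delta>" if "s \<in> {-L..R}" for s using that by force
  have gap: "\<mu> * indicator {0..R} s \<le> g (U s) - U s" if "s \<in> {-L..R}" for s
    using \<theta>[of s] \<mu>[of "U s"] less[OF that] U(2)[of s] g_gt[of "U s"] 
    by (cases "U s = 0") (auto simp: indicator_def)
  have abs: "\<bar>g (U s) - U s\<bar> \<le> B" for s
    using U(2,3)[of s] g_nonneg[of "U s"] g_le_B[of "U s"] by linarith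
  have i: "set_integrable lborel {-L..R} (\<lambda>s. g (U s) - U s)"
    by (rule set_integrable_bounded_Icc[OF _ abs]) (use U(1) in measurable)
  have i': "set_integrable lborel {-L..R} (\<lambda>s. \<mu> * indicator {0..R} s)"
    by (rule set_integrable_bounded_Icc[where B="\<bar>\<mu>\<bar>"]) (auto simp: indicator_def)
  have "R * \<mu> = (LINT s:{-L..R}|lborel. \<mu> * indicator {0..R} s)"
  proof -
    have "(\<lambda>s. indicator {-L..R} s *\<^sub>R (\<mu> * indicator {0..R} s)) = (\<lambda>s. \<mu> * indicator {0..R} s)"
      using LR by (auto simp: indicator_def)
    thus ?thesis unfolding set_lebesgue_integral_def using LR by (simp only:) simp
  qed
  also have "\<dots> \<le> (LINT s:{-L..R}|lborel. g (U s) - U s)"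
    by (rule set_integral_mono[OF i' i gap])
  also have "\<dots> \<le> B * expectation (\<lambda>x. \<bar>x\<bar>) + \<epsilon> * (R - - L)"
    by (rule set_integral_gap_le) (use U ge LR in auto)
  finally show False using R by simp
qed

end

section \<open>Passage to the limit\<close>

text \<open>The Arzela-Ascoli argument: a subsequence converges at all rationals, and the common
  Lipschitz constant carries the Cauchy property over to every real.\<close>

lemma lipschitz_convergent_subsequence:
  fixes W :: "nat \<Rightarrow> real \<Rightarrow> real"
  assumes range: "\<And>k s. W k s \<in> {a..b}" and lip: "\<And>k s t. \<bar>W k s - W k t\<bar> \<le> D * \<bar>s - t\<bar>"
  obtains r w where "strict_mono (r :: nat \<Rightarrow> nat)" "\<And>s. (\<lambda>k. W (r k) s) \<longlonglongrightarrow> w s"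
proof -
  define e where "e i = real_of_rat (nat_to_rat_surj i)" for i
  obtain z r where r: "strict_mono (r :: nat \<Rightarrow> nat)" and z: "\<And>i. (\<lambda>k. W (r k) (e i)) \<longlonglongrightarrow> z i"
    using pointwise_convergent_subsequence[of "\<lambda>k i. W k (e i)" a b] range by metis
  have D: "0 \<le> D" using lip[of 0 1 0] by auto
  have "convergent (\<lambda>k. W (r k) s)" for s
  proof (rule Cauchy_convergent, rule metric_CauchyI)
    fix \<epsilon> :: real assume \<epsilon>: "0 < \<epsilon>"
    \<comment> \<open>The \<open>+ 1\<close> covers D = 0.\<close>
    define d where "d = \<epsilon> / (3 * (D + 1))"
    have d: "0 < d" and Dd: "D * d < \<epsilon> / 3"
      using \<epsilon> D by (auto simp: d_def field_simps)
    obtain q where q: "s < real_of_rat q" "real_of_rat q < s + d" using of_rat_dense[of s "s + d"] d by auto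
    obtain i where "q = nat_to_rat_surj i" using surj_nat_to_rat_surj by (metis surjD)
    hence "\<bar>s - e i\<bar> \<le> d" using q by (simp add: e_def)
    hence near: "\<bar>W k s - W k (e i)\<bar> < \<epsilon> / 3" for k
      using lip[of k s "e i"] mult_left_mono[of "\<bar>s - e i\<bar>" d D] D Dd by linarith
    have "Cauchy (\<lambda>k. W (r k) (e i))" using z by (rule LIMSEQ_imp_Cauchy)
    then obtain M where M: "\<And>m n. m \<ge> M \<Longrightarrow> n \<ge> M \<Longrightarrow> \<bar>W (r m) (e i) - W (r n) (e i)\<bar> < \<epsilon> / 3"
      using metric_CauchyD[of _ "\<epsilon> / 3"] \<epsilon> by (fastforce simp: dist_real_def)
    have "dist (W (r m) s) (W (r n) s) < \<epsilon>" if "m \<ge> M" "n \<ge> M" for m n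
      using M[OF that] near[of "r m"] near[of "r n"] unfolding dist_real_def by linarith
    thus "\<exists>M. \<forall>m\<ge>M. \<forall>n\<ge>M. dist (W (r m) s) (W (r n) s) < \<epsilon>" by blast
  qed
  hence "(\<lambda>k. W (r k) s) \<longlonglongrightarrow> lim (\<lambda>k. W (r k) s)" for s by (simp add: convergent_LIMSEQ_iff)
  thus thesis by (intro that[OF r, of "\<lambda>s. lim (\<lambda>k. W (r k) s)"])
qed

context wave_equation
begin

text \<open>The parameters must be chosen in the order \<theta>, \<mu>, \<open>R\<close>,
  \<open>L\<close>, \<open>n\<close>: a lower floor shrinks the gap \<mu>, a smaller gap needs a
  longer \<open>R\<close>, the window must contain \<open>R\<close>, and the mesh must be fine
  relative to the window.\<close>

lemma translated_approximation:
  obtains V where "V \<in> borel_measurable borel" "\<And>s. 0 \<le> V s" "\<And>s. V s \<le> B"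
    "\<And>s. s < 0 \<Longrightarrow> V s < \<delta>" "\<exists>s\<in>{0..1 / Suc k}. \<delta> \<le> V s"
    "\<And>s. \<bar>s\<bar> + \<bar>ln \<delta> / \<nu>\<bar> \<le> k \<Longrightarrow> \<bar>V s - conv (\<lambda>s. g (V s)) s\<bar> \<le> 2 / Suc k"
proof -
  define \<theta> where "\<theta> = min 1 \<delta> / Suc k"
  have "\<theta> \<le> min 1 \<delta> / 1" unfolding \<theta>_def using \<delta>_pos by (intro divide_left_mono) auto
  hence \<theta>: "0 < \<theta>" "\<theta> \<le> 1" "\<theta> \<le> \<delta>" "\<theta> \<le> 1 / Suc k"
    using \<delta>_pos by (auto simp: \<theta>_def intro: divide_right_mono)
  have \<theta>B: "\<theta> \<le> B" using \<theta>(3) \<delta>_less_B by simp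
  obtain \<mu> where \<mu>: "0 < \<mu>" "\<And>u. \<theta> \<le> u \<Longrightarrow> u \<le> \<delta> \<Longrightarrow> u + \<mu> \<le> g u" using g_gap[OF \<theta>(1,3)] by blast
  define M where "M = B * expectation (\<lambda>x. \<bar>x\<bar>)"
  have M: "0 \<le> M" using B_pos by (auto simp: M_def)
  \<comment> \<open>R \<mu> = M + 2 leaves room for the mesh error \<epsilon> (R + L), which will be
    at most 1.\<close>
  define R where "R = (M + 2) / \<mu>"
  have R: "0 \<le> R" "M + 1 < R * \<mu>" using M \<mu> by (auto simp: R_def)
  \<comment> \<open>The translation \<open>t\<close> satisfies ln \<delta> / \<nu> \<le> t \<le> R,
    so this length keeps s + t inside the window for every \<open>s\<close> in the last
    claim.\<close>
  define L where "L = nat \<lceil>R + k + 1\<rceil>"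
  have L: "R + k + 1 \<le> L" unfolding L_def by linarith
  \<comment> \<open>One choice secures both \<epsilon> \<le> 1 / (k + 1) and \<epsilon> (R + L)
    \<le> 1.\<close>
  define n where "n = nat \<lceil>C * B * (R + L + Suc k)\<rceil> + 1"
  define \<epsilon> where "\<epsilon> = C * B / n"
  have CB: "0 \<le> C * B" using C_nonneg B_pos by simp
  have "C * B * (R + L + Suc k) \<le> n" unfolding n_def by linarith
  hence \<epsilon>': "\<epsilon> * (R + L + Suc k) \<le> 1" by (simp add: \<epsilon>_def n_def)
  have \<epsilon>0: "0 \<le> \<epsilon>" unfolding \<epsilon>_def using CB by simp
  have "\<epsilon> * Suc k \<le> \<epsilon> * (R + L + Suc k)" "\<epsilon> * (R + L) \<le> \<epsilon> * (R + L + Suc k)"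
    by (intro mult_left_mono \<epsilon>0; use R in simp)+
  hence \<epsilon>: "\<epsilon> \<le> 1 / Suc k" "\<epsilon> * (R + L) \<le> 1" using \<epsilon>' by (auto simp: field_simps)
  have n: "0 < n" by (simp add: n_def)
  obtain U where U: "U \<in> borel_measurable borel" "\<And>s. 0 \<le> U s" "\<And>s. U s \<le> B" "\<And>s. U s \<le> exp (\<nu> * s)"
    and Ueq: "\<And>s. - real L \<le> s \<Longrightarrow> s < real L \<Longrightarrow> \<bar>U s - conv (\<lambda>s. g (U s)) s\<bar> \<le> \<theta> + \<epsilon>"
    and Uge: "\<And>s. - real L \<le> s \<Longrightarrow> s < real L \<Longrightarrow> conv (\<lambda>s. g (U s)) s - \<epsilon> \<le> U s"
    and U\<theta>: "\<And>s. 0 \<le> s \<Longrightarrow> s < real L \<Longrightarrow> \<theta> \<le> U s"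
    unfolding \<epsilon>_def by (rule approximate_solution[OF \<theta>(1,2) \<theta>B n, where L = L]) blast
  have "\<exists>s\<in>{-real L..R}. \<delta> \<le> U s"
  proof (rule crossing[where \<theta> = \<theta> and \<mu> = \<mu> and \<epsilon> = \<epsilon>])
    show "B * expectation (\<lambda>x. \<bar>x\<bar>) + \<epsilon> * (R + L) < R * \<mu>" using R \<epsilon> by (simp add: M_def)
  qed (use U R L \<mu> Uge U\<theta> in auto)
  then obtain s0 where s0: "s0 \<le> R" "\<delta> \<le> U s0" by auto
  define S where "S = {s. \<delta> \<le> U s}"
  \<comment> \<open>Here the barrier is used: exp(\<nu> s) has not reached \<delta> to the left of
    ln \<delta> / \<nu>.\<close>
  have low: "ln \<delta> / \<nu> \<le> s" if "s \<in> S" for s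
  proof -
    have "\<delta> \<le> exp (\<nu> * s)" using that U(4)[of s] by (simp add: S_def)
    hence "ln \<delta> \<le> ln (exp (\<nu> * s))" using \<delta>_pos by (subst ln_le_cancel_iff) auto
    thus ?thesis using \<nu>_pos by (simp add: field_simps)
  qed
  have S: "bdd_below S" "S \<noteq> {}" using low s0 by (auto simp: S_def bdd_below_def)
  define t where "t = Inf S"
  have t: "ln \<delta> / \<nu> \<le> t" "t \<le> R"
    unfolding t_def using S low s0 by (auto simp: S_def intro: cInf_greatest cInf_lower2)
  define V where "V s = U (s + t)" for s
  have conv_V: "conv (\<lambda>s. g (V s)) s = conv (\<lambda>s. g (U s)) (s + t)" for s
    unfolding conv_def V_def by (simp add: algebra_simps)
  show thesis
  proof (rule that[of V])
    show "V \<in> borel_measurable borel" unfolding V_def using U(1) by measurable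
    show "V s < \<delta>" if "s < 0" for s
    proof (rule ccontr)
      assume "\<not> V s < \<delta>"
      hence "s + t \<in> S" by (simp add: S_def V_def)
      hence "Inf S \<le> s + t" by (rule cInf_lower[OF _ S(1)])
      thus False using that by (simp add: t_def[symmetric])
    qed
    have "Inf S < t + 1 / Suc k" by (simp add: t_def)
    then obtain y where y: "y \<in> S" "y < t + 1 / Suc k" using cInf_lessD[OF S(2)] by blast
    have "t \<le> y" unfolding t_def by (rule cInf_lower[OF y(1) S(1)])
    thus "\<exists>s\<in>{0..1 / Suc k}. \<delta> \<le> V s"
      using y by (intro bexI[of _ "y - t"]) (auto simp: V_def S_def)
    show "\<bar>V s - conv (\<lambda>s. g (V s)) s\<bar> \<le> 2 / Suc k" if "\<bar>s\<bar> + \<bar>ln \<delta> / \<nu>\<bar> \<le> k" for s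
    proof -
      have "- real L \<le> s + t" "s + t < real L" using that t L R(1) by linarith+
      from Ueq[OF this] \<epsilon>(1) \<theta>(4) show ?thesis unfolding conv_V by (simp add: V_def)
    qed
  qed (use U in \<open>auto simp: V_def\<close>)
qed

text \<open>The approximations \<open>V k\<close> have no common modulus of continuity, but their
  images \<open>W k\<close> share a Lipschitz constant. Compactness is applied to \<open>W\<close>,
  and the limit is transferred to \<open>V\<close> because the difference tends to 0 at each
  point.\<close>

lemma limit_solution:
  obtains \<phi> where "\<And>s t. \<bar>\<phi> s - \<phi> t\<bar> \<le> C * B * \<bar>s - t\<bar>" "\<And>s. 0 \<le> \<phi> s" "\<And>s. \<phi> s \<le> B"
    "\<And>s. \<phi> s = conv (\<lambda>s. g (\<phi> s)) s" "\<And>s. s < 0 \<Longrightarrow> \<phi> s \<le> \<delta>" "\<delta> \<le> \<phi> 0"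
proof -
  define A where "A = \<bar>ln \<delta> / \<nu>\<bar>"
  define P where "P k V \<longleftrightarrow> V \<in> borel_measurable borel \<and> (\<forall>s. 0 \<le> V s) \<and> (\<forall>s. V s \<le> B) \<and>
    (\<forall>s<0. V s < \<delta>) \<and> (\<exists>s\<in>{0..1 / Suc k}. \<delta> \<le> V s) \<and>
    (\<forall>s. \<bar>s\<bar> + A \<le> k \<longrightarrow> \<bar>V s - conv (\<lambda>s. g (V s)) s\<bar> \<le> 2 / Suc k)" for k :: nat and V :: "real \<Rightarrow> real"
  have "\<exists>V. P k V" for k
  proof (rule translated_approximation[of k])
    fix V :: "real \<Rightarrow> real" assume "V \<in> borel_measurable borel" "\<And>s. 0 \<le> V s" "\<And>s. V s \<le> B"
      "\<And>s. s < 0 \<Longrightarrow> V s < \<delta>" "\<exists>s\<in>{0..1 / Suc k}. \<delta> \<le> V s"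
      "\<And>s. \<bar>s\<bar> + \<bar>ln \<delta> / \<nu>\<bar> \<le> k \<Longrightarrow> \<bar>V s - conv (\<lambda>s. g (V s)) s\<bar> \<le> 2 / Suc k"
    hence "P k V" unfolding P_def A_def by (intro conjI allI impI)
    thus "\<exists>V. P k V" by (rule exI[of _ V])
  qed
  hence "\<exists>V. \<forall>k. P k (V k)" by (intro choice) blast
  then obtain V where PV: "\<And>k. P k (V k)" by blast
  note PV = PV[unfolded P_def]
  have V: "V k \<in> borel_measurable borel" for k using PV[of k] by blast
  have V0: "0 \<le> V k s" "V k s \<le> B" for k s using PV[of k] by blast+
  have V\<delta>: "V k s < \<delta>" if "s < 0" for k s using PV[of k] that by blast
  have Vcross: "\<exists>s\<in>{0..1 / Suc k}. \<delta> \<le> V k s" for k using PV[of k] by blast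
  have Veq: "\<bar>V k s - conv (\<lambda>s. g (V k s)) s\<bar> \<le> 2 / Suc k" if "\<bar>s\<bar> + A \<le> k" for k s
    using PV[of k] that by blast
  define W where "W k = conv (\<lambda>s. g (V k s))" for k
  note cg = compose_g[OF V]
  have W: "0 \<le> W k s" "W k s \<le> B" for k s unfolding W_def using conv_range[OF cg] by auto
  have lip: "\<bar>W k s - W k t\<bar> \<le> C * B * \<bar>s - t\<bar>" for k s t unfolding W_def by (rule conv_lipschitz[OF cg])
  obtain r \<phi> where r: "strict_mono (r :: nat \<Rightarrow> nat)" and lim: "\<And>s. (\<lambda>k. W (r k) s) \<longlonglongrightarrow> \<phi> s"
    using lipschitz_convergent_subsequence[of W 0 B "C * B", OF _ lip] W unfolding atLeastAtMost_iff by blast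
  have rk: "k \<le> r k" for k by (rule seq_suble[OF r])
  have inv_lim: "(\<lambda>k. D / real (Suc (r k))) \<longlonglongrightarrow> 0" for D
    using LIMSEQ_subseq_LIMSEQ[OF tendsto_mult[OF tendsto_const LIMSEQ_inverse_real_of_nat, of D] r]
    by (simp add: o_def divide_inverse)
  have large: "eventually (\<lambda>k. x \<le> real (r k)) sequentially" for x
  proof -
    have "x \<le> real (r k)" if "nat \<lceil>x\<rceil> \<le> k" for k using that rk[of k] by linarith
    thus ?thesis unfolding eventually_sequentially by blast
  qed
  have limV: "(\<lambda>k. V (r k) s) \<longlonglongrightarrow> \<phi> s" for s
  proof -
    have "(\<lambda>k. V (r k) s - W (r k) s) \<longlonglongrightarrow> 0"
    proof (rule Lim_null_comparison)
      show "\<forall>\<^sub>F k in sequentially. norm (V (r k) s - W (r k) s) \<le> 2 / real (Suc (r k))"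
        using large[of "\<bar>s\<bar> + A"] by eventually_elim (use Veq in \<open>simp add: W_def\<close>)
    qed (rule inv_lim)
    from tendsto_add[OF this lim[of s]] show ?thesis by simp
  qed
  have \<phi>lip: "\<bar>\<phi> s - \<phi> t\<bar> \<le> C * B * \<bar>s - t\<bar>" for s t
    by (rule LIMSEQ_le_const2[of "\<lambda>k. \<bar>W (r k) s - W (r k) t\<bar>"]) (auto intro!: tendsto_intros lim lip)
  have \<phi>meas: "\<phi> \<in> borel_measurable borel"
    by (rule borel_measurable_continuous_onI, rule lipschitz_continuous, rule \<phi>lip)
  have \<phi>0: "\<delta> \<le> \<phi> 0"
  proof (rule LIMSEQ_le[OF _ lim[of 0]])
    \<comment> \<open>The crossing point lies within 1 / (r k + 1) of the origin. The 2 is the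
      defect of the approximate equation there, and \<open>C * B\<close> accounts for the Lipschitz
      drift back to 0.\<close>
    show "(\<lambda>k. \<delta> - (2 + C * B) / real (Suc (r k))) \<longlonglongrightarrow> \<delta>"
      using tendsto_diff[OF tendsto_const inv_lim, of \<delta>] by simp
    have "\<forall>\<^sub>F k in sequentially. \<delta> - (2 + C * B) / real (Suc (r k)) \<le> W (r k) 0"
      using large[of "1 + A"]
    proof eventually_elim
      case (elim k)
      obtain s where s: "0 \<le> s" "s \<le> 1 / Suc (r k)" "\<delta> \<le> V (r k) s" using Vcross[of "r k"] by auto
      have "1 / real (Suc (r k)) \<le> 1" by simp
      hence "\<bar>s\<bar> + A \<le> r k" using s elim by linarith
      hence 1: "\<bar>V (r k) s - W (r k) s\<bar> \<le> 2 / Suc (r k)" unfolding W_def by (rule Veq)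
      have "\<bar>W (r k) s - W (r k) 0\<bar> \<le> C * B * \<bar>s - 0\<bar>" by (rule lip)
      also have "\<dots> \<le> C * B * (1 / Suc (r k))" using s C_nonneg B_pos by (intro mult_left_mono) auto
      finally show ?case using 1 s(3) by (simp add: add_divide_distrib)
    qed
    thus "\<exists>N. \<forall>k\<ge>N. \<delta> - (2 + C * B) / real (Suc (r k)) \<le> W (r k) 0"
      by (simp add: eventually_sequentially)
  qed
  have "\<phi> s = conv (\<lambda>s. g (\<phi> s)) s" for s
  proof (rule LIMSEQ_unique[OF lim])
    show "(\<lambda>k. W (r k) s) \<longlonglongrightarrow> conv (\<lambda>s. g (\<phi> s)) s"
      unfolding W_def by (rule conv_g_tendsto[OF V \<phi>meas limV])
  qed
  moreover have "0 \<le> \<phi> s" for s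
    by (rule LIMSEQ_le_const[OF lim[of s]]) (simp add: W)
  moreover have "\<phi> s \<le> B" for s
    by (rule LIMSEQ_le_const2[OF lim[of s]]) (simp add: W)
  moreover have "\<phi> s \<le> \<delta>" if "s < 0" for s
    by (rule LIMSEQ_le_const2[OF limV[of s]]) (use V\<delta>[OF that] in \<open>auto simp: less_imp_le\<close>)
  ultimately show thesis by (intro that[OF \<phi>lip _ _ _ _ \<phi>0])
qed

text \<open>Integrating \<open>\<phi> = N * g(\<phi>)\<close> over \<open>[-R, 0]\<close> bounds the integral of \<open>g(\<phi>) - \<phi> \<ge> 0\<close>
  independently of \<open>R\<close>, and this integrand stays away from zero wherever \<open>\<phi>\<close> does.\<close>

lemma vanishing_at_bot:
  assumes lip: "\<And>s t. \<bar>\<phi> s - \<phi> t\<bar> \<le> C * B * \<bar>s - t\<bar>" and \<phi>: "\<And>s. 0 \<le> \<phi> s" "\<And>s. \<phi> s \<le> B"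
    and eq: "\<And>s. \<phi> s = conv (\<lambda>s. g (\<phi> s)) s" and le: "\<And>s. s < 0 \<Longrightarrow> \<phi> s \<le> \<delta>"
  shows "(\<phi> \<longlongrightarrow> 0) at_bot"
proof -
  have cont: "continuous_on UNIV \<phi>" by (rule lipschitz_continuous, rule lip)
  have [measurable]: "\<phi> \<in> borel_measurable borel" by (rule borel_measurable_continuous_onI[OF cont])
  define I where "I R = (LINT s:{-R..0}|lborel. g (\<phi> s) - \<phi> s)" for R :: real
  have abs: "\<bar>g (\<phi> s) - \<phi> s\<bar> \<le> B" for s
    using \<phi>[of s] g_nonneg[of "\<phi> s"] g_le_B[of "\<phi> s"] by linarith
  have int: "set_integrable lborel {a..b} (\<lambda>s. g (\<phi> s) - \<phi> s)" for a b
    by (rule set_integrable_bounded_Icc[OF _ abs]) measurable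
  \<comment> \<open>The hypothesis stops short of 0; left continuity adds this point, which belongs
    to all intervals of integration.\<close>
  have le0: "\<phi> s \<le> \<delta>" if "s \<le> 0" for s
  proof (cases "s = 0")
    case True
    have "(\<phi> \<longlongrightarrow> \<phi> 0) (at_left 0)"
      using cont by (simp add: continuous_on_def filterlim_at_split)
    moreover have "\<forall>\<^sub>F s in at_left 0. \<phi> s \<le> \<delta>"
      using le by (auto simp: eventually_at_filter)
    ultimately show ?thesis using True by (simp add: tendsto_upperbound)
  qed (use le that in simp)
  have gap0: "0 \<le> g (\<phi> s) - \<phi> s" if "s \<le> 0" for s
    using le0[OF that] g_gt[of "\<phi> s"] \<phi>(1)[of s] by (cases "\<phi> s = 0") auto
  have I_bdd: "I R \<le> B * expectation (\<lambda>x. \<bar>x\<bar>)" if "0 \<le> R" for R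
  proof -
    have "I R \<le> B * expectation (\<lambda>x. \<bar>x\<bar>) + 0 * (0 - - R)"
      unfolding I_def by (rule set_integral_gap_le) (use \<phi> that in \<open>simp_all add: eq[symmetric]\<close>)
    thus ?thesis by simp
  qed
  have bdd: "bdd_above (I ` {0..})" using I_bdd by (auto simp: bdd_above_def)
  define J where "J = (SUP R\<in>{0..}. I R)"
  show ?thesis
  proof (rule tendstoI)
    fix \<epsilon>' :: real assume "0 < \<epsilon>'"
    define \<epsilon> where "\<epsilon> = min \<epsilon>' \<delta>"
    have \<epsilon>: "0 < \<epsilon>" "\<epsilon> \<le> \<delta>" "\<epsilon> \<le> \<epsilon>'" using \<open>0 < \<epsilon>'\<close> \<delta>_pos by (auto simp: \<epsilon>_def)
    obtain \<mu> where \<mu>: "0 < \<mu>" "\<And>u. \<epsilon> / 2 \<le> u \<Longrightarrow> u \<le> \<delta> \<Longrightarrow> u + \<mu> \<le> g u"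
      using g_gap[of "\<epsilon> / 2"] \<epsilon> by auto
    \<comment> \<open>By the Lipschitz bound \<phi>(-R) \<ge> \<epsilon> entails \<phi> \<ge>
      \<epsilon> / 2 on [-(R + d), -R], an interval that contributes at least \<mu> d to the
      integral. The \<open>+ 1\<close> covers C B = 0.\<close>
    define d where "d = \<epsilon> / (2 * (C * B + 1))"
    have CB: "0 \<le> C * B" using C_nonneg B_pos by simp
    have d: "0 < d" "C * B * d \<le> \<epsilon> / 2" using \<epsilon> CB by (auto simp: d_def field_simps)
    \<comment> \<open>Beyond \<open>R0\<close> less than \<mu> d of the supremum remains, so no such
      interval can lie there.\<close>
    have "J - \<mu> * d < J" using \<mu> d by simp
    then obtain R0 where R0: "0 \<le> R0" "J - \<mu> * d < I R0"
      unfolding J_def by (subst (asm) less_cSUP_iff) (use bdd in auto)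
    have small: "\<phi> (-R) < \<epsilon>" if R: "R0 \<le> R" "0 \<le> R" for R
    proof (rule ccontr)
      assume "\<not> ?thesis"
      hence big: "\<epsilon> \<le> \<phi> (-R)" by simp
      have gap: "\<mu> \<le> g (\<phi> s) - \<phi> s" if "s \<in> {-(R+d)..-R}" for s
      proof -
        have "\<bar>\<phi> s - \<phi> (-R)\<bar> \<le> C * B * \<bar>s - (-R)\<bar>" by (rule lip)
        also have "\<dots> \<le> C * B * d" using that CB by (intro mult_left_mono) auto
        finally have "\<epsilon> / 2 \<le> \<phi> s" using big d(2) by linarith
        moreover have "\<phi> s \<le> \<delta>" using le0[of s] that R by auto
        ultimately show ?thesis using \<mu>(2)[of "\<phi> s"] by simp
      qed
      have "\<mu> * d + I R0 \<le> I (R + d)"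
      proof -
        define w where "w s = (\<mu> * indicator {-(R+d)..-R} s + indicator {-R0<..0} s * (g (\<phi> s) - \<phi> s) :: real)" for s
        \<comment> \<open>Dropping the left end point makes the two supports in \<open>w\<close>
          disjoint even when R = R0.\<close>
        have I_R0: "I R0 = (LINT s:{-R0<..0}|lborel. g (\<phi> s) - \<phi> s)"
          unfolding I_def set_lebesgue_integral_def
          by (rule integral_cong_AE) (use AE_lborel_singleton[of "-R0"] in \<open>auto elim!: eventually_mono simp: indicator_def\<close>)
        have int0: "set_integrable lborel {-R0<..0} (\<lambda>s. g (\<phi> s) - \<phi> s)"
          by (rule set_integrable_subset[OF int[of "-R0" 0]]) auto
        have "\<mu> * d + I R0 = (\<integral>s. w s \<partial>lborel)"
          unfolding w_def I_R0 set_lebesgue_integral_def using int0 d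
          by (subst Bochner_Integration.integral_add) (auto simp: set_integrable_def)
        also have "\<dots> \<le> I (R + d)"
          unfolding I_def set_lebesgue_integral_def
        proof (rule integral_mono)
          show "integrable lborel w" unfolding w_def using int0 d by (auto simp: set_integrable_def)
          show "integrable lborel (\<lambda>s. indicator {-(R+d)..0} s *\<^sub>R (g (\<phi> s) - \<phi> s))"
            using int[of "-(R+d)" 0] by (simp add: set_integrable_def)
          show "w s \<le> indicator {-(R+d)..0} s *\<^sub>R (g (\<phi> s) - \<phi> s)" for s
            using gap[of s] gap0[of s] R R0(1) d(1) by (auto simp: w_def indicator_def)
        qed
        finally show ?thesis .
      qed
      moreover have "I (R + d) \<le> J" unfolding J_def by (rule cSUP_upper) (use R d bdd in auto)
      ultimately show False using R0(2) by simp
    qed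
    have "dist (\<phi> s) 0 < \<epsilon>'" if "s \<le> - R0" for s
      using small[of "-s"] that R0(1) \<phi>(1)[of s] \<epsilon>(3) by simp
    thus "\<forall>\<^sub>F s in at_bot. dist (\<phi> s) 0 < \<epsilon>'"
      by (auto simp: eventually_at_bot_linorder)
  qed
qed

end

section \<open>The characteristic function and its thresholds\<close>

text \<open>The hypothesis \<open>convex\<close> is what strict convexity gives at level 0. Of three
  roots the middle one would have a negative value, and a nonpositive root together with
  \<open>z\<close> would make f(0) nonpositive.\<close>

lemma exactly_two_roots:
  fixes f :: "real \<Rightarrow> real"
  assumes cont: "continuous_on UNIV f"
    and convex: "\<And>x y z. x < y \<Longrightarrow> y < z \<Longrightarrow> f x \<le> 0 \<Longrightarrow> f z \<le> 0 \<Longrightarrow> f y < 0"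
    and f: "0 < f 0" "0 < z" "f z < 0" "z < Z" "0 < f Z"
  shows "card {x. f x = 0} = 2 \<and> (\<forall>x. f x = 0 \<longrightarrow> 0 < x)"
proof -
  have cont': "continuous_on S f" for S using cont continuous_on_subset by blast
  obtain a where a: "0 \<le> a" "a \<le> z" "f a = 0" using IVT2'[of f z 0 0] f cont' by auto
  obtain b where b: "z \<le> b" "b \<le> Z" "f b = 0" using IVT'[of f z 0 Z] f cont' by auto
  have "a \<noteq> z" "b \<noteq> z" using f a b by auto
  hence ab: "a < z" "z < b" using a b by auto
  have "x = a \<or> x = b" if "f x = 0" for x
    using convex[of x a b] convex[of a x b] convex[of a b x] that a b ab
    by (cases x a rule: linorder_cases; cases x b rule: linorder_cases) auto
  hence "{x. f x = 0} = {a, b}" using a b by auto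
  moreover have "0 < x" if "f x = 0" for x
    using convex[of x 0 z] f that by (cases x "0::real" rule: linorder_cases) auto
  ultimately show ?thesis using ab by auto
qed

locale characteristic =
  fixes K :: "real \<Rightarrow> real" and h p q :: real
  assumes h_nonneg: "0 \<le> h" and K_nonneg: "\<And>s. 0 \<le> K s"
    and K_exp: "\<And>\<mu>. integrable lebesgue (\<lambda>s. K s * exp (\<mu> * s))"
    and K_mass: "(\<integral>s. K s \<partial>lebesgue) = 1"
    and q_pos: "0 < q" and q_less_p: "q < p"
begin

text \<open>The bilateral Laplace transform of \<open>K\<close>.\<close>

definition transform :: "real \<Rightarrow> real" where
  "transform \<nu> = (\<integral>s. K s * exp (- \<nu> * s) \<partial>lebesgue)"

text \<open>Substituting \<open>\<nu> = c z\<close> and \<open>\<epsilon> = c\<^sup>-\<^sup>2\<close> in \<open>psi\<close> makes the dependence on the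
  parameter monotone on each half-line.\<close>

definition char_fun :: "real \<Rightarrow> real \<Rightarrow> real" where
  "char_fun \<nu> c = \<nu>\<^sup>2 - c * \<nu> - q + p * (exp (- (\<nu> * c * h)) * transform \<nu>)"

lemma p_pos: "0 < p" using q_pos q_less_p by simp

lemma transform_shift:
  "exp (- (\<nu> * a)) * transform \<nu> = (\<integral>s. K s * exp (- \<nu> * (s + a)) \<partial>lebesgue)"
  "integrable lebesgue (\<lambda>s. K s * exp (- \<nu> * (s + a)))"
proof -
  have eq: "K s * exp (- \<nu> * (s + a)) = exp (- (\<nu> * a)) * (K s * exp (- \<nu> * s))" for s
    by (simp add: algebra_simps flip: exp_add)
  show "exp (- (\<nu> * a)) * transform \<nu> = (\<integral>s. K s * exp (- \<nu> * (s + a)) \<partial>lebesgue)"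
    unfolding eq transform_def by simp
  show "integrable lebesgue (\<lambda>s. K s * exp (- \<nu> * (s + a)))"
    unfolding eq by (intro integrable_mult_right K_exp)
qed

text \<open>Products of convex functions need not be convex, but by \<open>transform_shift\<close>
  this one is again a superposition of exponentials in \<nu> with the nonnegative weight
  \<open>K\<close>.\<close>

lemma convex_exp_transform: "convex_on UNIV (\<lambda>\<nu>. exp (- (\<nu> * a)) * transform \<nu>)"
proof (rule convex_onI)
  fix t x y :: real assume t: "0 < t" "t < 1"
  have "(\<integral>s. K s * exp (- ((1 - t) * x + t * y) * (s + a)) \<partial>lebesgue)
    \<le> (\<integral>s. (1 - t) * (K s * exp (- x * (s + a))) + t * (K s * exp (- y * (s + a))) \<partial>lebesgue)"
  proof (rule integral_mono)
    show "integrable lebesgue (\<lambda>s. (1 - t) * (K s * exp (- x * (s + a))) + t * (K s * exp (- y * (s + a))))"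
      by (intro Bochner_Integration.integrable_add integrable_mult_right transform_shift)
    fix s
    have "exp ((1 - t) *\<^sub>R (- x * (s + a)) + t *\<^sub>R (- y * (s + a)))
        \<le> (1 - t) * exp (- x * (s + a)) + t * exp (- y * (s + a))"
      using t by (intro convex_onD[OF exp_convex]) auto
    hence "K s * exp (- ((1 - t) * x + t * y) * (s + a)) \<le> K s * ((1 - t) * exp (- x * (s + a)) + t * exp (- y * (s + a)))"
      by (intro mult_left_mono K_nonneg) (simp add: algebra_simps)
    thus "K s * exp (- ((1 - t) * x + t * y) * (s + a))
        \<le> (1 - t) * (K s * exp (- x * (s + a))) + t * (K s * exp (- y * (s + a)))"
      by (simp add: algebra_simps)
  qed (rule transform_shift)
  also have "\<dots> = (1 - t) * (exp (- (x * a)) * transform x) + t * (exp (- (y * a)) * transform y)"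
    unfolding transform_shift(1) by (subst Bochner_Integration.integral_add)
      (use transform_shift(2) in \<open>auto intro!: integrable_mult_right\<close>)
  finally show "exp (- (((1 - t) *\<^sub>R x + t *\<^sub>R y) * a)) * transform ((1 - t) *\<^sub>R x + t *\<^sub>R y)
      \<le> (1 - t) * (exp (- (x * a)) * transform x) + t * (exp (- (y * a)) * transform y)"
    unfolding transform_shift(1) by simp
qed simp

lemma isCont_transform: "isCont transform \<nu>"
proof -
  have "convex_on UNIV transform" using convex_exp_transform[of 0] by simp
  hence "continuous_on UNIV transform" by (intro convex_on_continuous) auto
  thus ?thesis by (simp add: continuous_on_eq_continuous_at)
qed

lemma transform_pos: "0 < transform \<nu>"
proof -
  have nn: "0 \<le> transform \<nu>" unfolding transform_def by (intro Bochner_Integration.integral_nonneg) (auto simp: K_nonneg)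
  have "transform \<nu> \<noteq> 0"
  proof
    assume "transform \<nu> = 0"
    hence "AE s in lebesgue. K s * exp (- \<nu> * s) = 0"
      unfolding transform_def by (subst (asm) integral_nonneg_eq_0_iff_AE) (use K_exp[of "- \<nu>"] in \<open>auto simp: K_nonneg\<close>)
    hence "AE s in lebesgue. K s = 0" by eventually_elim simp
    hence "(\<integral>s. K s \<partial>lebesgue) = 0" by (rule integral_eq_zero_AE)
    thus False using K_mass by simp
  qed
  with nn show ?thesis by simp
qed

lemma transform_0: "transform 0 = 1" using K_mass by (simp add: transform_def)

lemma char_fun_0: "0 < char_fun 0 c" using q_less_p by (simp add: char_fun_def transform_0)

text \<open>Strictness comes from \<nu>^2, whose convexity defect is t (1 - t) (z - x)^2; the
  remaining terms are affine or convex.\<close>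

lemma char_fun_convex:
  assumes "x < y" "y < z" "char_fun x c \<le> 0" "char_fun z c \<le> 0"
  shows "char_fun y c < 0"
proof -
  define t where "t = (y - x) / (z - x)"
  have t: "0 < t" "t < 1" using assms by (auto simp: t_def)
  have "(1 - t) * x + t * z = x + t * (z - x)" by (simp add: algebra_simps)
  also have "\<dots> = y" using assms by (simp add: t_def)
  finally have y: "y = (1 - t) * x + t * z" by simp
  define k where "k \<nu> = exp (- (\<nu> * (c * h))) * transform \<nu>" for \<nu>
  have cf: "char_fun \<nu> c = \<nu>\<^sup>2 - c * \<nu> - q + p * k \<nu>" for \<nu> by (simp add: char_fun_def k_def mult.assoc)
  have "k ((1 - t) *\<^sub>R x + t *\<^sub>R z) \<le> (1 - t) * k x + t * k z"
    using t convex_onD[OF convex_exp_transform[of "c * h"], of t x z] by (simp add: k_def)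
  hence "k y \<le> (1 - t) * k x + t * k z" unfolding y by simp
  hence k: "p * k y \<le> (1 - t) * (p * k x) + t * (p * k z)"
    using mult_left_mono[of "k y" "(1 - t) * k x + t * k z" p] p_pos by (simp add: algebra_simps)
  have "(1 - t) * x\<^sup>2 + t * z\<^sup>2 - y\<^sup>2 = t * (1 - t) * (z - x)\<^sup>2"
    unfolding y by (simp add: power2_eq_square algebra_simps)
  moreover have "0 < t * (1 - t) * (z - x)\<^sup>2" using t assms by simp
  ultimately have "y\<^sup>2 < (1 - t) * x\<^sup>2 + t * z\<^sup>2" by linarith
  moreover have "c * y = (1 - t) * (c * x) + t * (c * z)" "q = (1 - t) * q + t * q"
    unfolding y by (simp_all add: algebra_simps)
  ultimately have "char_fun y c < (1 - t) * char_fun x c + t * char_fun z c"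
    using k unfolding cf by (simp only: ring_distribs)
  also have "\<dots> \<le> 0"
    using mult_left_mono[OF assms(3), of "1 - t"] mult_left_mono[OF assms(4), of t] t by simp
  finally show ?thesis .
qed

lemma char_fun_tendsto:
  assumes "(x \<longlongrightarrow> \<nu>) F" "(y \<longlongrightarrow> c) F"
  shows "((\<lambda>n. char_fun (x n) (y n)) \<longlongrightarrow> char_fun \<nu> c) F"
  unfolding char_fun_def
  by (intro tendsto_intros assms isCont_tendsto_compose[OF isCont_transform])

lemma char_fun_antimono:
  assumes "0 < \<nu>" "c < c'"
  shows "char_fun \<nu> c' < char_fun \<nu> c"
proof -
  have "\<nu> * c * h \<le> \<nu> * c' * h" using assms h_nonneg by (intro mult_right_mono mult_left_mono) auto
  hence "p * (exp (- (\<nu> * c' * h)) * transform \<nu>) \<le> p * (exp (- (\<nu> * c * h)) * transform \<nu>)"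
    using p_pos transform_pos[of \<nu>] by (intro mult_left_mono mult_right_mono) auto
  moreover have "c * \<nu> < c' * \<nu>" using assms by simp
  ultimately show ?thesis unfolding char_fun_def by linarith
qed

lemma char_fun_mono:
  assumes "\<nu> < 0" "c < c'"
  shows "char_fun \<nu> c < char_fun \<nu> c'"
proof -
  have "\<nu> * c' * h \<le> \<nu> * c * h" using assms h_nonneg by (intro mult_right_mono mult_left_mono_neg) auto
  hence "p * (exp (- (\<nu> * c * h)) * transform \<nu>) \<le> p * (exp (- (\<nu> * c' * h)) * transform \<nu>)"
    using p_pos transform_pos[of \<nu>] by (intro mult_left_mono mult_right_mono) auto
  moreover have "c' * \<nu> < c * \<nu>" using assms by simp
  ultimately show ?thesis unfolding char_fun_def by linarith
qed

text \<open>For such \<nu> one has \<nu>^2 - c \<nu> \<ge> (q + 1) |\<nu>| \<ge> q + 1. The bound is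
  uniform in |c| \<le> D, so roots cannot escape to infinity while the speed varies in a bounded
  range.\<close>

lemma char_fun_pos:
  assumes "c \<le> D" "- D \<le> c" "0 \<le> D" "D + q + 1 \<le> \<bar>\<nu>\<bar>"
  shows "0 < char_fun \<nu> c"
proof -
  have "\<bar>c\<bar> \<le> D" using assms by auto
  hence "c * \<nu> \<le> D * \<bar>\<nu>\<bar>"
    using mult_right_mono[of "\<bar>c\<bar>" D "\<bar>\<nu>\<bar>"] abs_ge_self[of "c * \<nu>"] by (simp add: abs_mult)
  moreover have "(D + q + 1) * \<bar>\<nu>\<bar> \<le> \<bar>\<nu>\<bar> * \<bar>\<nu>\<bar>" using assms by (intro mult_right_mono) auto
  moreover have "(q + 1) * 1 \<le> (q + 1) * \<bar>\<nu>\<bar>" using q_pos assms by (intro mult_left_mono) auto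
  moreover have "\<bar>\<nu>\<bar> * \<bar>\<nu>\<bar> = \<nu>\<^sup>2" by (simp add: power2_eq_square)
  ultimately have "0 < \<nu>\<^sup>2 - c * \<nu> - q" by (simp add: algebra_simps)
  moreover have "0 < p * (exp (- (\<nu> * c * h)) * transform \<nu>)" using p_pos transform_pos by simp
  ultimately show ?thesis unfolding char_fun_def by linarith
qed

text \<open>The points \<open>x n\<close> stay bounded by \<open>char_fun_pos\<close> and cannot
  accumulate at 0, where the value is p - q > 0. With \<open>S\<close> a closed half-line, the limit
  point keeps its strict sign; this is how critical parameters are reached.\<close>

lemma char_fun_limit:
  assumes c: "c \<longlonglongrightarrow> c0" and x: "\<And>n. char_fun (x n) (c n) \<le> 0" and S: "\<And>n. x n \<in> S" "closed S"
  obtains \<nu> where "\<nu> \<in> S" "\<nu> \<noteq> 0" "char_fun \<nu> c0 \<le> 0"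
proof -
  have "Bseq c" using c by (intro convergent_imp_Bseq convergentI)
  then obtain D where D: "0 < D" "\<And>n. \<bar>c n\<bar> \<le> D" unfolding Bseq_def by auto
  have bnd: "\<bar>x n\<bar> \<le> D + q + 1" for n
    using char_fun_pos[of "c n" D "x n"] D(1) D(2)[of n] x[of n] by force
  have "x n \<in> S \<inter> {-(D + q + 1)..D + q + 1}" for n using S(1)[of n] bnd[of n] unfolding abs_le_iff Int_iff atLeastAtMost_iff by linarith
  moreover have "compact (S \<inter> {-(D + q + 1)..D + q + 1})"
    using S(2) by (intro closed_Int_compact) auto
  ultimately obtain \<nu> r where r: "\<nu> \<in> S" "strict_mono (r :: nat \<Rightarrow> nat)" "(x \<circ> r) \<longlonglongrightarrow> \<nu>"
    using compact_imp_seq_compact unfolding seq_compact_def by (metis Int_iff)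
  have "(\<lambda>n. char_fun ((x \<circ> r) n) ((c \<circ> r) n)) \<longlonglongrightarrow> char_fun \<nu> c0"
    by (intro char_fun_tendsto r LIMSEQ_subseq_LIMSEQ[OF c r(2)])
  hence "char_fun \<nu> c0 \<le> 0" by (rule LIMSEQ_le_const2) (use x in auto)
  moreover from this have "\<nu> \<noteq> 0" using char_fun_0[of c0] by auto
  ultimately show thesis using r that by blast
qed

section \<open>Real roots of \<open>psi\<close> in terms of the characteristic function\<close>

lemma psi_eq_char_fun:
  assumes "0 < \<epsilon>"
  shows "psi K h p q z \<epsilon> = char_fun (z * sqrt \<epsilon>) (1 / sqrt \<epsilon>)"
  using assms by (simp add: psi_def char_fun_def transform_def power_mult_distrib algebra_simps)

lemma psi_roots:
  assumes "0 < \<epsilon>"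
  shows "{z. psi K h p q z \<epsilon> = 0} = (\<lambda>\<nu>. \<nu> / sqrt \<epsilon>) ` {\<nu>. char_fun \<nu> (1 / sqrt \<epsilon>) = 0}"
  using assms by (force simp: psi_eq_char_fun image_iff)

lemma card_psi_roots:
  assumes "0 < \<epsilon>"
  shows "card {z. psi K h p q z \<epsilon> = 0} = card {\<nu>. char_fun \<nu> (1 / sqrt \<epsilon>) = 0}"
  unfolding psi_roots[OF assms] using assms by (intro card_image) (auto simp: inj_on_def)

lemma char_fun_isCont: "continuous_on UNIV (\<lambda>\<nu>. char_fun \<nu> c)"
  unfolding continuous_on_def by (intro ballI char_fun_tendsto tendsto_intros)

lemma psi_positive_roots:
  assumes "0 < \<epsilon>" "0 < \<nu>" "char_fun \<nu> (1 / sqrt \<epsilon>) < 0"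
  shows "card {z. psi K h p q z \<epsilon> = 0} = 2" "psi K h p q z \<epsilon> = 0 \<Longrightarrow> 0 < z"
proof -
  define c where "c = 1 / sqrt \<epsilon>"
  define Z where "Z = \<bar>c\<bar> + q + 1 + \<nu>"
  have "card {\<nu>. char_fun \<nu> c = 0} = 2 \<and> (\<forall>\<nu>. char_fun \<nu> c = 0 \<longrightarrow> 0 < \<nu>)"
  proof (rule exactly_two_roots[where z = \<nu> and Z = Z, OF char_fun_isCont])
    show "char_fun y c < 0" if "x < y" "y < z" "char_fun x c \<le> 0" "char_fun z c \<le> 0" for x y z
      by (rule char_fun_convex[OF that])
    show "0 < char_fun Z c" using assms q_pos by (intro char_fun_pos[of _ "\<bar>c\<bar>"]) (auto simp: Z_def)
    show "\<nu> < Z" using q_pos by (simp add: Z_def)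
  qed (use assms char_fun_0 in \<open>simp_all add: c_def\<close>)
  thus "card {z. psi K h p q z \<epsilon> = 0} = 2" "psi K h p q z \<epsilon> = 0 \<Longrightarrow> 0 < z"
    using card_psi_roots[OF assms(1)] psi_eq_char_fun[OF assms(1), of z] assms(1)
    by (auto simp: c_def zero_less_mult_iff)
qed

lemma psi_negative_roots:
  assumes "0 < \<epsilon>" "\<nu> < 0" "char_fun \<nu> (1 / sqrt \<epsilon>) < 0"
  shows "card {z. psi K h p q z \<epsilon> = 0} = 2" "psi K h p q z \<epsilon> = 0 \<Longrightarrow> z < 0"
proof -
  define c where "c = 1 / sqrt \<epsilon>"
  define Z where "Z = \<bar>c\<bar> + q + 1 - \<nu>"
  \<comment> \<open>Reflection at 0 reduces negative roots to
    \<open>exactly_two_roots\<close>.\<close>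
  have "card {\<nu>. char_fun (- \<nu>) c = 0} = 2 \<and> (\<forall>\<nu>. char_fun (- \<nu>) c = 0 \<longrightarrow> 0 < \<nu>)"
  proof (rule exactly_two_roots[where z = "- \<nu>" and Z = Z])
    show "continuous_on UNIV (\<lambda>\<nu>. char_fun (- \<nu>) c)"
      using continuous_on_compose[OF _ continuous_on_subset[OF char_fun_isCont], of UNIV uminus]
      by (simp add: o_def continuous_on_minus)
    show "char_fun (- y) c < 0" if "x < y" "y < z" "char_fun (- x) c \<le> 0" "char_fun (- z) c \<le> 0" for x y z
      using that by (intro char_fun_convex[of "-z" "-y" "-x"]) auto
    show "0 < char_fun (- Z) c" using assms q_pos by (intro char_fun_pos[of _ "\<bar>c\<bar>"]) (auto simp: Z_def)
  qed (use assms q_pos char_fun_0 abs_ge_zero[of c] in \<open>simp_all add: c_def[symmetric] Z_def del: abs_ge_zero\<close>)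
  moreover have "{\<nu>. char_fun (- \<nu>) c = 0} = uminus ` {\<nu>. char_fun \<nu> c = 0}" by force
  moreover have "card (uminus ` {\<nu>. char_fun \<nu> c = 0}) = card {\<nu>. char_fun \<nu> c = 0}"
    by (intro card_image) auto
  ultimately have *: "card {\<nu>. char_fun \<nu> c = 0} = 2" "\<And>\<nu>. char_fun (- \<nu>) c = 0 \<Longrightarrow> 0 < \<nu>" by auto
  show "card {z. psi K h p q z \<epsilon> = 0} = 2" using *(1) card_psi_roots[OF assms(1)] by (simp add: c_def)
  show "z < 0" if "psi K h p q z \<epsilon> = 0"
    using *(2)[of "- (z * sqrt \<epsilon>)"] that psi_eq_char_fun[OF assms(1), of z] assms(1)
    by (auto simp: c_def mult_less_0_iff)
qed

section \<open>Existence and uniqueness of the threshold pair\<close>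

definition pos_range :: "real set" where
  "pos_range = {\<epsilon>. 0 < \<epsilon> \<and> (\<exists>\<nu>>0. char_fun \<nu> (1 / sqrt \<epsilon>) < 0)}"

definition neg_range :: "real set" where
  "neg_range = {\<epsilon>. 0 < \<epsilon> \<and> (\<exists>\<nu><0. char_fun \<nu> (1 / sqrt \<epsilon>) < 0)}"

text \<open>Strict monotonicity in the speed turns a mere zero at \<epsilon> into a negative value
  at every smaller parameter, at the same \<nu>.\<close>

lemma pos_range_downward:
  assumes "0 < \<nu>" "char_fun \<nu> (1 / sqrt \<epsilon>) \<le> 0" "0 < \<epsilon>'" "\<epsilon>' < \<epsilon>"
  shows "\<epsilon>' \<in> pos_range"
proof -
  have "1 / sqrt \<epsilon> < 1 / sqrt \<epsilon>'" using assms by (intro divide_strict_left_mono) auto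
  from char_fun_antimono[OF assms(1) this] assms show ?thesis by (force simp: pos_range_def)
qed

lemma neg_range_upward:
  assumes "\<nu> < 0" "char_fun \<nu> (1 / sqrt \<epsilon>) \<le> 0" "0 < \<epsilon>" "\<epsilon> < \<epsilon>'"
  shows "\<epsilon>' \<in> neg_range"
proof -
  have "1 / sqrt \<epsilon>' < 1 / sqrt \<epsilon>" using assms by (intro divide_strict_left_mono) auto
  from char_fun_mono[OF assms(1) this] assms show ?thesis by (force simp: neg_range_def)
qed

text \<open>Convexity would force a negative value at 0, where the value is p - q > 0.\<close>

lemma no_roots_of_both_signs:
  assumes "\<nu> < 0" "char_fun \<nu> c \<le> 0" "0 < \<nu>'" "char_fun \<nu>' c \<le> 0"
  shows False
  using char_fun_convex[of \<nu> 0 \<nu>' c] char_fun_0[of c] assms by simp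

lemma pos_range_limit:
  assumes "0 < \<epsilon>" "\<And>\<epsilon>'. 0 < \<epsilon>' \<Longrightarrow> \<epsilon>' < \<epsilon> \<Longrightarrow> \<epsilon>' \<in> pos_range"
  obtains \<nu> where "0 < \<nu>" "char_fun \<nu> (1 / sqrt \<epsilon>) \<le> 0"
proof -
  \<comment> \<open>The index shift by two keeps \<open>e 0\<close> positive.\<close>
  define e where "e n = \<epsilon> * (1 - inverse (real (Suc (Suc n))))" for n
  have "e \<longlonglongrightarrow> \<epsilon> * (1 - 0)"
    unfolding e_def by (intro tendsto_intros LIMSEQ_Suc[OF LIMSEQ_inverse_real_of_nat])
  hence "(\<lambda>n. 1 / sqrt (e n)) \<longlonglongrightarrow> 1 / sqrt \<epsilon>" using assms(1) by (intro tendsto_intros) auto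
  moreover have "e n \<in> pos_range" for n
  proof -
    have "0 < inverse (real (Suc (Suc n)))" "inverse (real (Suc (Suc n))) < 1" by (auto simp: field_simps)
    thus ?thesis using assms(1) by (intro assms(2)) (auto simp: e_def right_diff_distrib)
  qed
  hence "\<exists>x. \<forall>n. 0 < x n \<and> char_fun (x n) (1 / sqrt (e n)) < 0"
    by (intro choice) (auto simp: pos_range_def)
  then obtain x where x: "\<And>n. 0 < x n" "\<And>n. char_fun (x n) (1 / sqrt (e n)) < 0" by blast
  ultimately obtain \<nu> where "\<nu> \<in> {0..}" "\<nu> \<noteq> 0" "char_fun \<nu> (1 / sqrt \<epsilon>) \<le> 0"
    using char_fun_limit[of "\<lambda>n. 1 / sqrt (e n)" "1 / sqrt \<epsilon>" x "{0..}"]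
    by (metis atLeast_iff closed_real_atLeast less_imp_le)
  thus thesis using that[of \<nu>] by auto
qed

lemma neg_range_limit:
  assumes "0 < \<epsilon>" "\<And>\<epsilon>'. \<epsilon> < \<epsilon>' \<Longrightarrow> \<epsilon>' \<in> neg_range"
  obtains \<nu> where "\<nu> < 0" "char_fun \<nu> (1 / sqrt \<epsilon>) \<le> 0"
proof -
  define e where "e n = \<epsilon> * (1 + inverse (real (Suc n)))" for n
  have "e \<longlonglongrightarrow> \<epsilon> * (1 + 0)"
    unfolding e_def by (intro tendsto_intros LIMSEQ_inverse_real_of_nat)
  hence "(\<lambda>n. 1 / sqrt (e n)) \<longlonglongrightarrow> 1 / sqrt \<epsilon>" using assms(1) by (intro tendsto_intros) auto
  moreover have "e n \<in> neg_range" for n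
    by (rule assms(2)) (use assms(1) in \<open>auto simp: e_def distrib_left\<close>)
  hence "\<exists>x. \<forall>n. x n < 0 \<and> char_fun (x n) (1 / sqrt (e n)) < 0"
    by (intro choice) (auto simp: neg_range_def)
  then obtain x where x: "\<And>n. x n < 0" "\<And>n. char_fun (x n) (1 / sqrt (e n)) < 0" by blast
  ultimately obtain \<nu> where "\<nu> \<in> {..0}" "\<nu> \<noteq> 0" "char_fun \<nu> (1 / sqrt \<epsilon>) \<le> 0"
    using char_fun_limit[of "\<lambda>n. 1 / sqrt (e n)" "1 / sqrt \<epsilon>" x "{..0}"]
    by (metis atMost_iff closed_real_atMost less_imp_le)
  thus thesis using that[of \<nu>] by auto
qed

lemma pos_range_nonempty: "pos_range \<noteq> {}"
proof -
  \<comment> \<open>At \<nu> = 1 this speed makes the value at most - 1 - q.\<close>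
  define c where "c = 2 + p * transform 1"
  have c: "0 < c" using p_pos transform_pos[of 1] by (simp add: c_def add_pos_pos)
  have "exp (- (1 * c * h)) * transform 1 \<le> 1 * transform 1"
    using c h_nonneg transform_pos[of 1] by (intro mult_right_mono) auto
  hence "p * (exp (- (1 * c * h)) * transform 1) \<le> p * transform 1" using p_pos by simp
  hence "char_fun 1 c < 0" using q_pos unfolding char_fun_def c_def by simp
  moreover have "1 / sqrt (1 / c\<^sup>2) = c" using c by (simp add: real_sqrt_divide)
  ultimately have "1 / c\<^sup>2 \<in> pos_range" using c by (auto simp: pos_range_def intro!: exI[of _ 1])
  thus ?thesis by auto
qed

text \<open>By monotonicity \<open>pos_range\<close> is an initial and \<open>neg_range\<close> a
  final piece of the positive reals, and no parameter lies in both. The thresholds are their inner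
  ends; an empty \<open>neg_range\<close> has infimum \<infinity>, as it should.\<close>

lemma threshold_pair: "is_threshold_pair K h p q (Sup (ereal ` pos_range)) (Inf (ereal ` neg_range))"
proof -
  define e0 where "e0 = Sup (ereal ` pos_range)"
  define e1 where "e1 = Inf (ereal ` neg_range)"
  have below: "\<epsilon> \<in> pos_range" if "0 < \<epsilon>" "ereal \<epsilon> < e0" for \<epsilon>
    using that pos_range_downward[of _ _ \<epsilon>] unfolding e0_def less_Sup_iff by (force simp: pos_range_def)
  have above: "\<epsilon> \<in> neg_range" if "e1 < ereal \<epsilon>" for \<epsilon>
    using that neg_range_upward[of _ _ \<epsilon>] unfolding e1_def Inf_less_iff by (force simp: neg_range_def)
  have le0: "ereal \<epsilon> \<le> e0" if "\<epsilon> \<in> pos_range" for \<epsilon> unfolding e0_def using that by (intro Sup_upper) auto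
  have le1: "e1 \<le> ereal \<epsilon>" if "\<epsilon> \<in> neg_range" for \<epsilon> unfolding e1_def using that by (intro Inf_lower) auto
  have e0_pos: "0 < e0"
  proof -
    obtain \<epsilon> where "\<epsilon> \<in> pos_range" using pos_range_nonempty by auto
    thus ?thesis using le0[of \<epsilon>] less_le_trans[of 0 "ereal \<epsilon>" e0] by (auto simp: pos_range_def)
  qed
  have disjoint: "a \<le> b" if "a \<in> pos_range" "b \<in> neg_range" for a b
  proof (rule ccontr)
    assume "\<not> a \<le> b"
    hence b: "b \<in> pos_range" using that pos_range_downward[of _ a b] by (force simp: pos_range_def neg_range_def)
    then obtain \<nu> \<nu>' where "\<nu> < 0" "char_fun \<nu> (1 / sqrt b) < 0" "0 < \<nu>'" "char_fun \<nu>' (1 / sqrt b) < 0"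
      using b \<open>b \<in> neg_range\<close> by (auto simp: pos_range_def neg_range_def)
    thus False using no_roots_of_both_signs[of \<nu> "1 / sqrt b" \<nu>'] by simp
  qed
  have "e0 \<le> e1" unfolding e0_def e1_def by (intro Sup_least Inf_greatest) (use disjoint in auto)
  moreover have "0 < psi K h p q z \<epsilon>" if lt: "e0 < ereal \<epsilon>" "ereal \<epsilon> < e1" for z \<epsilon>
  proof (rule ccontr)
    have \<epsilon>: "0 < \<epsilon>" using less_trans[OF e0_pos that(1)] by simp
    assume "\<not> ?thesis"
    hence neg: "char_fun (z * sqrt \<epsilon>) (1 / sqrt \<epsilon>) \<le> 0" unfolding psi_eq_char_fun[OF \<epsilon>] by simp
    consider "z * sqrt \<epsilon> = 0" | "0 < z * sqrt \<epsilon>" | "z * sqrt \<epsilon> < 0" by linarith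
    thus False
    proof cases
      case 1
      show ?thesis using neg char_fun_0[of "1 / sqrt \<epsilon>"] unfolding 1 by simp
    next
      case 2
      \<comment> \<open>Such a \<open>y\<close> would belong to \<open>pos_range\<close> although it
        exceeds the supremum; the negative case is symmetric.\<close>
      obtain y where y: "e0 < ereal y" "y < \<epsilon>" using ereal_dense2[OF lt(1)] by auto
      have "0 < y" using less_trans[OF e0_pos y(1)] by simp
      from le0[OF pos_range_downward[OF 2 neg this y(2)]] y(1) show ?thesis by simp
    next
      case 3
      obtain y where y: "\<epsilon> < y" "ereal y < e1" using ereal_dense2[OF lt(2)] by auto
      from le1[OF neg_range_upward[OF 3 neg \<epsilon> y(1)]] y(2) show ?thesis by simp
    qed
  qed
  moreover have "e0 = \<infinity> \<and> e1 = \<infinity>" if "e0 = e1"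
  proof (rule ccontr)
    assume "\<not> ?thesis"
    hence "e0 \<noteq> \<infinity>" using that by simp
    then obtain e where e: "e0 = ereal e" using e0_pos by (cases e0) auto
    have e': "e1 = ereal e" using that e by simp
    have "0 < e" using e0_pos e by simp
    \<comment> \<open>Both ranges reach \<open>e\<close> from opposite sides, so at \<open>e\<close>
      itself there would be nonpositive values at arguments of both signs.\<close>
    obtain \<nu> where 1: "0 < \<nu>" "char_fun \<nu> (1 / sqrt e) \<le> 0"
      by (rule pos_range_limit[OF \<open>0 < e\<close>]) (use below e in auto)
    obtain \<nu>' where 2: "\<nu>' < 0" "char_fun \<nu>' (1 / sqrt e) \<le> 0"
      by (rule neg_range_limit[OF \<open>0 < e\<close>]) (use above e' in auto)
    show False by (rule no_roots_of_both_signs[OF 2 1])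
  qed
  moreover have "card {z. psi K h p q z \<epsilon> = 0} = 2 \<and> (\<forall>z. psi K h p q z \<epsilon> = 0 \<longrightarrow> 0 < z)"
    if lt: "0 < \<epsilon>" "ereal \<epsilon> < e0" for \<epsilon>
  proof -
    obtain \<nu> where "0 < \<nu>" "char_fun \<nu> (1 / sqrt \<epsilon>) < 0"
      using below[OF lt] unfolding pos_range_def by blast
    from psi_positive_roots[OF lt(1) this] show ?thesis by blast
  qed
  moreover have "card {z. psi K h p q z \<epsilon> = 0} = 2 \<and> (\<forall>z. psi K h p q z \<epsilon> = 0 \<longrightarrow> z < 0)"
    if lt: "e1 < ereal \<epsilon>" for \<epsilon>
  proof -
    obtain \<nu> where "0 < \<epsilon>" "\<nu> < 0" "char_fun \<nu> (1 / sqrt \<epsilon>) < 0"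
      using above[OF lt] unfolding neg_range_def by blast
    from psi_negative_roots[OF this] show ?thesis by blast
  qed
  ultimately show ?thesis
    using e0_pos unfolding is_threshold_pair_def e0_def[symmetric] e1_def[symmetric] by blast
qed

text \<open>At a parameter strictly between \<open>a\<close> and the smaller of \<open>a'\<close>
  and \<open>b\<close>, one pair demands two roots and the other demands none. Applied in both
  directions this gives the uniqueness behind \<open>eps0\<close>.\<close>

lemma threshold_pair_le:
  assumes 1: "is_threshold_pair K h p q a b" and 2: "is_threshold_pair K h p q a' b'"
  shows "a' \<le> a"
proof (rule ccontr)
  assume "\<not> ?thesis"
  hence less: "a < a'" by simp
  have "a < b" using 1 less unfolding is_threshold_pair_def by (metis le_neq_trans not_less_iff_gr_or_eq ereal_less_PInfty ereal_infty_less(1))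
  then obtain e where e: "a < ereal e" "ereal e < min a' b" using ereal_dense2[of a "min a' b"] less by auto
  have "0 < a" using 1 by (simp add: is_threshold_pair_def)
  hence "0 < ereal e" using e(1) by (rule less_trans)
  hence "0 < e" by simp
  have "card {z. psi K h p q z e = 0} = 2" using 2 e \<open>0 < e\<close> by (simp add: is_threshold_pair_def)
  moreover have "0 < psi K h p q z e" for z using 1 e by (simp add: is_threshold_pair_def)
  hence "{z. psi K h p q z e = 0} = {}" by (metis (mono_tags, lifting) Collect_empty_eq less_irrefl)
  ultimately show False by simp
qed

lemma eps0_eq: "eps0 K h p q = Sup (ereal ` pos_range)"
  unfolding eps0_def
proof (rule the_equality)
  show "\<exists>b. is_threshold_pair K h p q (Sup (ereal ` pos_range)) b" using threshold_pair by blast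
  show "a = Sup (ereal ` pos_range)" if "\<exists>b. is_threshold_pair K h p q a b" for a
    using that threshold_pair threshold_pair_le by (meson antisym)
qed

text \<open>The hypothesis means 1 / c^2 \<le> \<epsilon>0 with equality allowed. Hence only
  parameters below 1 / c^2 are known to lie in \<open>pos_range\<close>, and the critical speed
  needs the limit argument.\<close>

lemma speed_condition:
  assumes c: "0 < c" "inv_sqrt_ereal (eps0 K h p q) \<le> c"
  obtains \<nu> where "0 < \<nu>" "char_fun \<nu> c \<le> 0"
proof -
  define e0 where "e0 = eps0 K h p q"
  have pair: "is_threshold_pair K h p q e0 (Inf (ereal ` neg_range))"
    using threshold_pair by (simp add: eps0_eq e0_def)
  have e0: "ereal (1 / c\<^sup>2) \<le> e0"
  proof (cases e0)
    case (real e)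
    have e: "0 < e" using pair real by (simp add: is_threshold_pair_def)
    have "1 / sqrt e \<le> c" using c(2) real by (simp add: inv_sqrt_ereal_def e0_def)
    hence "1 \<le> c * sqrt e" using e by (simp add: field_simps)
    hence "1 \<le> (c * sqrt e)\<^sup>2" by (simp add: one_le_power)
    thus ?thesis using e c real by (simp add: power_mult_distrib field_simps)
  qed (use pair in \<open>auto simp: is_threshold_pair_def\<close>)
  have "\<epsilon> \<in> pos_range" if "0 < \<epsilon>" "\<epsilon> < 1 / c\<^sup>2" for \<epsilon>
  proof -
    have "ereal \<epsilon> < Sup (ereal ` pos_range)" using less_le_trans[of "ereal \<epsilon>", OF _ e0] that by (simp add: e0_def eps0_eq)
    then obtain \<epsilon>' where "\<epsilon>' \<in> pos_range" "\<epsilon> < \<epsilon>'" unfolding less_Sup_iff by auto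
    thus ?thesis using pos_range_downward[of _ \<epsilon>' \<epsilon>] that by (force simp: pos_range_def)
  qed
  then obtain \<nu> where "0 < \<nu>" "char_fun \<nu> (1 / sqrt (1 / c\<^sup>2)) \<le> 0"
    using pos_range_limit[of "1 / c\<^sup>2"] c by auto
  moreover have "1 / sqrt (1 / c\<^sup>2) = c" using c by (simp add: real_sqrt_divide)
  ultimately show thesis using that by simp
qed

end

section \<open>The Green function\<close>

text \<open>The minimum selects exp(- a r) for r \<ge> 0 and exp(b r) for r < 0, so estimates can be
  made on each exponential without a case distinction. The total mass is 1 / (a b).\<close>

definition green :: "real \<Rightarrow> real \<Rightarrow> real \<Rightarrow> real" where
  "green a b r = min (exp (- a * r)) (exp (b * r)) / (a + b)"

lemma has_bochner_integral_exp_atLeast: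
  fixes \<alpha> :: real
  assumes "0 < \<alpha>"
  shows "has_bochner_integral lborel (\<lambda>x. indicator {0..} x * exp (- \<alpha> * x)) (1 / \<alpha>)"
proof (rule has_bochner_integral_nn_integral)
  have "((\<lambda>x. - exp (- \<alpha> * x) / \<alpha>) \<longlongrightarrow> - 0 / \<alpha>) at_top"
    using assms by (intro tendsto_intros filterlim_compose[OF exp_at_bot])
      (auto simp: filterlim_uminus_at_bot intro!: filterlim_tendsto_pos_mult_at_top[OF tendsto_const] filterlim_ident)
  hence "(\<integral>\<^sup>+x. ennreal (exp (- \<alpha> * x)) * indicator {0..} x \<partial>lborel) = ennreal (- 0 / \<alpha> - (- exp (- \<alpha> * 0) / \<alpha>))"
    using assms by (intro nn_integral_FTC_atLeast) (auto intro!: derivative_eq_intros)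
  thus "(\<integral>\<^sup>+x. ennreal (indicator {0..} x * exp (- \<alpha> * x)) \<partial>lborel) = ennreal (1 / \<alpha>)"
    by (simp add: ennreal_mult' ennreal_indicator mult.commute)
qed (use assms in auto)

context
  fixes a b :: real
  assumes ab: "0 < a" "0 < b"
begin

lemma green_pos: "0 < green a b r"
  using ab by (simp add: green_def)

lemma green_measurable [measurable]: "green a b \<in> borel_measurable borel"
  unfolding green_def by measurable

lemma green_eq:
  "green a b r = (if 0 \<le> r then exp (- a * r) else exp (b * r)) / (a + b)"
proof (cases "0 \<le> r")
  case True
  hence "0 \<le> (a + b) * r" using ab by simp
  thus ?thesis using True by (simp add: green_def min_def algebra_simps)
next
  case False
  hence "(a + b) * r \<le> 0" using ab by (simp add: mult_nonneg_nonpos)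
  thus ?thesis using False by (simp add: green_def min_def algebra_simps)
qed

text \<open>Both exponents have slope of size at most a + b, so a shift by \<open>d\<close> costs
  either exponential at most the factor exp(- (a + b) |d|), and the minimum inherits this.\<close>

lemma green_harnack: "exp (- (a + b) * \<bar>d\<bar>) * green a b r \<le> green a b (r + d)"
proof -
  have *: "exp (- (a + b) * \<bar>d\<bar>) * exp (k * r) \<le> exp (k * (r + d))" if "\<bar>k\<bar> \<le> a + b" for k
  proof -
    have "- (k * d) \<le> \<bar>k\<bar> * \<bar>d\<bar>" using abs_ge_minus_self[of "k * d"] by (simp add: abs_mult)
    also have "\<dots> \<le> (a + b) * \<bar>d\<bar>" using that by (intro mult_right_mono) auto
    finally show ?thesis by (simp add: algebra_simps flip: exp_add)
  qed
  have "exp (- (a + b) * \<bar>d\<bar>) * min (exp (- a * r)) (exp (b * r))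
      \<le> min (exp (- a * (r + d))) (exp (b * (r + d)))"
  proof (rule min.boundedI)
    have "exp (- (a + b) * \<bar>d\<bar>) * min (exp (- a * r)) (exp (b * r)) \<le> exp (- (a + b) * \<bar>d\<bar>) * exp (- a * r)"
      by (intro mult_left_mono) auto
    also have "\<dots> \<le> exp (- a * (r + d))" using ab by (intro *) simp
    finally show "exp (- (a + b) * \<bar>d\<bar>) * min (exp (- a * r)) (exp (b * r)) \<le> exp (- a * (r + d))" .
    have "exp (- (a + b) * \<bar>d\<bar>) * min (exp (- a * r)) (exp (b * r)) \<le> exp (- (a + b) * \<bar>d\<bar>) * exp (b * r)"
      by (intro mult_left_mono) auto
    also have "\<dots> \<le> exp (b * (r + d))" using ab by (intro *) simp
    finally show "exp (- (a + b) * \<bar>d\<bar>) * min (exp (- a * r)) (exp (b * r)) \<le> exp (b * (r + d))" .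
  qed
  from divide_right_mono[OF this, of "a + b"] ab show ?thesis by (simp add: green_def)
qed

lemma green_exp_moment:
  assumes "- a < \<nu>" "\<nu> < b"
  shows "has_bochner_integral lborel (\<lambda>r. exp (- \<nu> * r) * green a b r) (1 / ((a + \<nu>) * (b - \<nu>)))"
proof -
  have 1: "has_bochner_integral lborel (\<lambda>x. indicator {0..} x * exp (- (a + \<nu>) * x)) (1 / (a + \<nu>))"
    using assms by (intro has_bochner_integral_exp_atLeast) simp
  have "has_bochner_integral lborel (\<lambda>x. indicator {0..} x * exp (- (b - \<nu>) * x)) (1 / (b - \<nu>))"
    using assms by (intro has_bochner_integral_exp_atLeast) simp
  hence 2: "has_bochner_integral lborel (\<lambda>x. indicator {0..} (- x) * exp (- (b - \<nu>) * (- x))) (1 / (b - \<nu>))"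
    using lborel_has_bochner_integral_real_affine_iff[of "-1" "\<lambda>x. indicator {0..} x * exp (- (b - \<nu>) * x)" "1 / (b - \<nu>)" 0]
    by simp
  have "has_bochner_integral lborel (\<lambda>r. exp (- \<nu> * r) * green a b r)
    ((1 / (a + \<nu>) + 1 / (b - \<nu>)) / (a + b))"
  proof (rule has_bochner_integral_cong_AE[THEN iffD1, OF _ _ _ has_bochner_integral_divide_zero[OF has_bochner_integral_add[OF 1 2], of "a + b"]])
    show "AE x in lborel. (indicator {0..} x * exp (- (a + \<nu>) * x) + indicator {0..} (- x) * exp (- (b - \<nu>) * (- x))) / (a + b)
        = exp (- \<nu> * x) * green a b x"
      \<comment> \<open>At 0 both indicators equal 1, so the identity holds only almost
        everywhere.\<close>
      using AE_lborel_singleton[of 0]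
      by eventually_elim (auto simp: green_eq indicator_def algebra_simps simp flip: exp_add)
  qed (use ab in auto)
  moreover have "(1 / x + 1 / y) / (x + y) = 1 / (x * y)" if "0 < x" "0 < y" for x y :: real
    using that by (simp add: divide_simps)
  from this[of "a + \<nu>" "b - \<nu>"]
  have "(1 / (a + \<nu>) + 1 / (b - \<nu>)) / (a + b) = 1 / ((a + \<nu>) * (b - \<nu>))"
    using assms by simp
  ultimately show ?thesis by simp
qed

lemma green_integrable: "integrable lborel (green a b)"
  using green_exp_moment[of 0] ab by (auto simp: has_bochner_integral_iff)

lemma green_mult_integrable:
  assumes "G \<in> borel_measurable borel" "\<And>y. \<bar>G y\<bar> \<le> B"
  shows "integrable lborel (\<lambda>y. green a b (t - y) * G y)"
proof (rule Bochner_Integration.integrable_bound)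
  show "integrable lborel (\<lambda>y. B * green a b (t - y))"
    using lborel_integrable_real_affine[OF green_integrable, of "-1" t] by (intro integrable_mult_right) simp
  show "AE y in lborel. norm (green a b (t - y) * G y) \<le> norm (B * green a b (t - y))"
  proof (intro AE_I2)
    fix y
    have "\<bar>G y\<bar> * green a b (t - y) \<le> \<bar>B\<bar> * green a b (t - y)"
      using assms(2)[of y] green_pos[of "t - y"] by (intro mult_right_mono) auto
    thus "norm (green a b (t - y) * G y) \<le> norm (B * green a b (t - y))"
      using green_pos[of "t - y"] by (simp add: abs_mult mult.commute)
  qed
qed (use assms in measurable)

lemma green_conv_commute:
  "(\<integral>r. green a b r * G (t - r) \<partial>lborel) = (\<integral>y. green a b (t - y) * G y \<partial>lborel)"
  using lborel_integral_real_affine[of "-1" "\<lambda>r. green a b r * G (t - r)" t] by simp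

end

text \<open>For primitives taken from -\<infinity> or up to \<infinity>: only increments over
  compact intervals enter, with k = 1 or k = - 1 respectively.\<close>

lemma has_real_derivative_of_increments:
  fixes f H :: "real \<Rightarrow> real"
  assumes f: "continuous_on UNIV f" and H: "\<And>c s. c \<le> s \<Longrightarrow> H s = H c + k * integral {c..s} f"
  shows "(H has_real_derivative k * f t) (at t)"
proof -
  have "((\<lambda>s. integral {t-1..s} f) has_real_derivative f t) (at t within {t-1..t+1})"
    by (intro integral_has_real_derivative continuous_on_subset[OF f]) auto
  hence "((\<lambda>s. integral {t-1..s} f) has_real_derivative f t) (at t)"
    using at_within_Icc_at[of "t-1" t "t+1"] by simp
  hence "((\<lambda>s. H (t - 1) + k * integral {t-1..s} f) has_real_derivative k * f t) (at t)"
    by (auto intro!: derivative_eq_intros)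
  moreover have "\<forall>\<^sub>F s in nhds t. H (t - 1) + k * integral {t-1..s} f = H s"
    by (rule eventually_mono[OF eventually_nhds_in_open[of "{t-1<..}" t]])
       (auto intro!: H[symmetric])
  ultimately show ?thesis
    using DERIV_cong_ev[OF refl _ refl, of "\<lambda>s. H (t - 1) + k * integral {t-1..s} f" H t "k * f t"] by blast
qed

text \<open>\<open>green a b\<close> is the Green function of \<open>- x'' + (b - a) x' + x\<close> when \<open>a b = 1\<close>.\<close>

lemma green_differential_equation:
  fixes G \<Phi> :: "real \<Rightarrow> real"
  assumes ab: "0 < a" "0 < b" "a * b = 1"
    and G: "continuous_on UNIV G" "\<And>y. \<bar>G y\<bar> \<le> B"
    and \<Phi>: "\<And>t. \<Phi> t = (\<integral>r. green a b r * G (t - r) \<partial>lborel)"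
  obtains \<Phi>' \<Phi>'' where "\<And>t. (\<Phi> has_real_derivative \<Phi>' t) (at t)"
    "\<And>t. (\<Phi>' has_real_derivative \<Phi>'' t) (at t)"
    "continuous_on UNIV \<Phi>'" "continuous_on UNIV \<Phi>''"
    "\<And>t. \<Phi>'' t - (b - a) * \<Phi>' t - \<Phi> t + G t = 0"
proof -
  have [measurable]: "G \<in> borel_measurable borel" by (rule borel_measurable_continuous_onI[OF G(1)])
  \<comment> \<open>Splitting the convolution at y = t and pulling out exp(- a t) and exp(b t)
    leaves integrands independent of \<open>t\<close>; then \<open>t\<close> occurs only in
    prefactors and limits of integration.\<close>
  define f1 where "f1 y = exp (a * y) * G y" for y
  define f2 where "f2 y = exp (- b * y) * G y" for y
  have c1: "continuous_on UNIV f1" and c2: "continuous_on UNIV f2"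
    unfolding f1_def f2_def using G(1) by (auto intro!: continuous_intros)
  have green1: "green a b (t - y) * G y = exp (- a * t) / (a + b) * f1 y" if "y \<le> t" for t y
    using that ab by (simp add: green_eq f1_def algebra_simps flip: exp_add)
  have green2: "green a b (t - y) * G y = exp (b * t) / (a + b) * f2 y" if "t \<le> y" for t y
    using that ab by (cases "t = y") (simp_all add: green_eq f2_def algebra_simps flip: exp_add)
  note int = green_mult_integrable[OF ab(1,2) _ G(2)]
  have i: "set_integrable lborel S (\<lambda>y. green a b (t - y) * G y)" if "S \<in> sets borel" for S t
    unfolding set_integrable_def by (intro integrable_mult_indicator int) (use that in auto)
  have on1: "(\<lambda>y. green a b (t - y) * G y) integrable_on {..t}" for t
    by (rule set_borel_integral_eq_integral(1)[OF i]) simp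
  have on2: "(\<lambda>y. green a b (t - y) * G y) integrable_on {t..}" for t
    by (rule set_borel_integral_eq_integral(1)[OF i]) simp
  have f1_on: "f1 integrable_on {..t}" for t
  proof -
    have "(\<lambda>y. exp (- a * t) / (a + b) * f1 y) integrable_on {..t}"
      by (rule integrable_eq[OF on1[of t]]) (simp add: green1)
    thus ?thesis using ab by (subst (asm) integrable_on_cmult_iff) auto
  qed
  have f2_on: "f2 integrable_on {t..}" for t
  proof -
    have "(\<lambda>y. exp (b * t) / (a + b) * f2 y) integrable_on {t..}"
      by (rule integrable_eq[OF on2[of t]]) (simp add: green2)
    thus ?thesis using ab by (subst (asm) integrable_on_cmult_iff) auto
  qed
  define E where "E t = integral {..t} f1" for t
  define F where "F t = integral {t..} f2" for t
  have incr1: "E s = E c + 1 * integral {c..s} f1" if "c \<le> s" for c s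
  proof -
    have "(f1 has_integral E c + integral {c..s} f1) ({..c} \<union> {c..s})"
      unfolding E_def by (intro has_integral_Un integrable_integral f1_on integrable_continuous_real continuous_on_subset[OF c1])
        (use that in \<open>auto intro: negligible_subset[of "{c}"]\<close>)
    moreover have "{..c} \<union> {c..s} = {..s}" using that by auto
    ultimately show ?thesis unfolding E_def by (simp add: integral_unique)
  qed
  have incr2: "F s = F c + (- 1) * integral {c..s} f2" if "c \<le> s" for c s
  proof -
    have "(f2 has_integral integral {c..s} f2 + F s) ({c..s} \<union> {s..})"
      unfolding F_def by (intro has_integral_Un integrable_integral f2_on integrable_continuous_real continuous_on_subset[OF c2])
        (use that in \<open>auto intro: negligible_subset[of "{s}"]\<close>)
    moreover have "{c..s} \<union> {s..} = {c..}" using that by auto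
    ultimately show ?thesis unfolding F_def by (simp add: integral_unique)
  qed
  have dE: "(E has_real_derivative 1 * f1 t) (at t)" for t
    by (rule has_real_derivative_of_increments[OF c1 incr1])
  have dF: "(F has_real_derivative (- 1) * f2 t) (at t)" for t
    by (rule has_real_derivative_of_increments[OF c2 incr2])
  define P where "P t = exp (- a * t) * E t" for t
  define Q where "Q t = exp (b * t) * F t" for t
  have dP: "(P has_real_derivative G t - a * P t) (at t)" for t
    unfolding P_def by (rule derivative_eq_intros dE refl | simp)+ (simp add: f1_def algebra_simps flip: exp_add)
  have dQ: "(Q has_real_derivative b * Q t - G t) (at t)" for t
    unfolding Q_def by (rule derivative_eq_intros dF refl | simp)+ (simp add: f2_def algebra_simps flip: exp_add)
  have \<Phi>_eq: "\<Phi> t = (P t + Q t) / (a + b)" for t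
  proof -
    have "((\<lambda>y. green a b (t - y) * G y) has_integral \<Phi> t) UNIV"
      unfolding \<Phi> green_conv_commute[OF ab(1,2)] by (intro has_integral_integral_lborel int) auto
    moreover have "((\<lambda>y. green a b (t - y) * G y) has_integral
        exp (- a * t) / (a + b) * E t + exp (b * t) / (a + b) * F t) ({..t} \<union> {t..})"
    proof (rule has_integral_Un)
      show "((\<lambda>y. green a b (t - y) * G y) has_integral exp (- a * t) / (a + b) * E t) {..t}"
        by (rule has_integral_eq[OF _ has_integral_mult_right[OF integrable_integral[OF f1_on[of t], folded E_def]]]) (simp add: green1)
      show "((\<lambda>y. green a b (t - y) * G y) has_integral exp (b * t) / (a + b) * F t) {t..}"
        by (rule has_integral_eq[OF _ has_integral_mult_right[OF integrable_integral[OF f2_on[of t], folded F_def]]]) (simp add: green2)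
      show "negligible ({..t} \<inter> {t..})" by (rule negligible_subset[of "{t}"]) auto
    qed
    moreover have "{..t} \<union> {t..} = UNIV" by auto
    ultimately show ?thesis by (simp add: has_integral_unique P_def Q_def add_divide_distrib)
  qed
  \<comment> \<open>The terms with \<open>G\<close> in the derivatives of \<open>P\<close> and
    \<open>Q\<close> cancel, so \<Phi>' is again a combination of \<open>P\<close> and
    \<open>Q\<close> and can be differentiated once more for merely continuous
    \<open>G\<close>.\<close>
  define \<Phi>' where "\<Phi>' t = (b * Q t - a * P t) / (a + b)" for t
  define \<Phi>'' where "\<Phi>'' t = (b * (b * Q t - G t) - a * (G t - a * P t)) / (a + b)" for t
  have cPQ: "continuous_on UNIV P" "continuous_on UNIV Q"
    using dP dQ by (auto intro!: DERIV_isCont continuous_at_imp_continuous_on)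
  show thesis
  proof (rule that)
    show "(\<Phi> has_real_derivative \<Phi>' t) (at t)" for t
      unfolding \<Phi>_eq[abs_def] \<Phi>'_def using ab by (auto intro!: derivative_eq_intros dP dQ)
    show "(\<Phi>' has_real_derivative \<Phi>'' t) (at t)" for t
      unfolding \<Phi>'_def[abs_def] \<Phi>''_def using ab by (auto intro!: derivative_eq_intros dP dQ)
    show "continuous_on UNIV \<Phi>'" "continuous_on UNIV \<Phi>''"
      unfolding \<Phi>'_def[abs_def] \<Phi>''_def[abs_def] using ab cPQ G(1) by (auto intro!: continuous_intros)
    show "\<Phi>'' t - (b - a) * \<Phi>' t - \<Phi> t + G t = 0" for t
    proof -
      have cancel: "a * (b * x) = x" for x using ab(3) by (simp flip: mult.assoc)
      have "(\<Phi>'' t - (b - a) * \<Phi>' t - \<Phi> t + G t) * (a + b) = 0"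
        unfolding \<Phi>'_def \<Phi>''_def \<Phi>_eq using ab by (simp add: divide_simps) (simp add: algebra_simps cancel)
      thus ?thesis using ab by simp
    qed
  qed
qed

section \<open>The wave measure\<close>

context characteristic
begin

section \<open>The probability law with density \<open>K\<close>\<close>

lemma K_integrable: "integrable lebesgue K"
  using K_exp[of 0] by simp

lemma K_measurable [measurable]: "K \<in> borel_measurable lebesgue"
  using K_integrable by (rule borel_measurable_integrable)

text \<open>\<open>K\<close> is only Lebesgue measurable. The identity map transports its law to the
  Borel sets, where product measures and compositions with Borel functions behave well.\<close>

definition jump :: "real measure" where
  "jump = distr (density lebesgue K) borel (\<lambda>x. x)"

lemma id_lebesgue_borel: "(\<lambda>x. x) \<in> lebesgue \<rightarrow>\<^sub>M borel"
  by (rule measurable_completion) simp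

lemma sets_jump [measurable_cong]: "sets jump = sets borel"
  by (simp add: jump_def)

lemma jump_integral:
  fixes v :: "real \<Rightarrow> real"
  assumes "v \<in> borel_measurable borel"
  shows "integrable jump v \<longleftrightarrow> integrable lebesgue (\<lambda>s. K s * v s)"
    and "(\<integral>s. v s \<partial>jump) = (\<integral>s. K s * v s \<partial>lebesgue)"
proof -
  have v: "v \<in> borel_measurable lebesgue" using measurable_compose[OF id_lebesgue_borel assms] .
  have m: "(\<lambda>x. x) \<in> density lebesgue K \<rightarrow>\<^sub>M borel" using id_lebesgue_borel by simp
  show "integrable jump v \<longleftrightarrow> integrable lebesgue (\<lambda>s. K s * v s)"
    unfolding jump_def integrable_distr_eq[OF m assms]
    by (rule integrable_real_density) (use v K_nonneg in auto)
  show "(\<integral>s. v s \<partial>jump) = (\<integral>s. K s * v s \<partial>lebesgue)"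
    unfolding jump_def integral_distr[OF m assms]
    by (rule integral_real_density) (use v K_nonneg in auto)
qed

lemma prob_space_jump: "prob_space jump"
proof -
  have "(\<integral>\<^sup>+s. ennreal (K s) \<partial>lebesgue) = ennreal (\<integral>s. K s \<partial>lebesgue)"
    by (rule nn_integral_eq_integral[OF K_integrable]) (simp add: K_nonneg)
  hence "prob_space (density lebesgue K)"
    by (intro prob_spaceI) (simp add: emeasure_density K_mass)
  thus ?thesis unfolding jump_def
    by (rule prob_space.prob_space_distr) (use id_lebesgue_borel in simp)
qed

lemma jump_exp:
  "integrable jump (\<lambda>w. exp (- \<nu> * w))" "(\<integral>w. exp (- \<nu> * w) \<partial>jump) = transform \<nu>"
  using K_exp[of "- \<nu>"] by (simp_all add: jump_integral transform_def)

context
  fixes a b c :: real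
  assumes ab: "0 < a" "0 < b" "a * b = 1"
begin

section \<open>The law of Green variable plus jump plus delay\<close>

definition resolvent :: "real measure" where
  "resolvent = density lborel (green a b)"

definition wave_measure :: "real measure" where
  "wave_measure = distr (resolvent \<Otimes>\<^sub>M jump) borel (\<lambda>z. fst z + snd z + c * h)"

lemma sets_resolvent [measurable_cong]: "sets resolvent = sets borel"
  by (simp add: resolvent_def)

lemma resolvent_integral:
  fixes v :: "real \<Rightarrow> real"
  assumes "v \<in> borel_measurable borel"
  shows "integrable resolvent v \<longleftrightarrow> integrable lborel (\<lambda>r. green a b r * v r)"
    and "(\<integral>r. v r \<partial>resolvent) = (\<integral>r. green a b r * v r \<partial>lborel)"
proof -
  have "green a b \<in> borel_measurable lborel" "AE r in lborel. 0 \<le> green a b r" "v \<in> borel_measurable lborel"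
    using assms green_pos[OF ab(1,2)] green_measurable[OF ab(1,2)] by (auto simp: less_imp_le)
  from integrable_real_density[OF this] integral_real_density[OF this]
  show "integrable resolvent v \<longleftrightarrow> integrable lborel (\<lambda>r. green a b r * v r)"
    "(\<integral>r. v r \<partial>resolvent) = (\<integral>r. green a b r * v r \<partial>lborel)"
    unfolding resolvent_def by auto
qed

lemma resolvent_exp:
  assumes "- a < \<nu>" "\<nu> < b"
  shows "integrable resolvent (\<lambda>r. exp (- \<nu> * r))"
    and "(\<integral>r. exp (- \<nu> * r) \<partial>resolvent) = 1 / ((a + \<nu>) * (b - \<nu>))"
  using green_exp_moment[OF ab(1,2) assms]
  by (simp_all add: resolvent_integral has_bochner_integral_iff mult.commute)

lemma prob_space_resolvent: "prob_space resolvent"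
proof (rule prob_spaceI)
  have "(\<integral>\<^sup>+r. ennreal (green a b r) \<partial>lborel) = ennreal (\<integral>r. green a b r \<partial>lborel)"
    by (rule nn_integral_eq_integral[OF green_integrable[OF ab(1,2)]])
       (use green_pos[OF ab(1,2)] in \<open>auto simp: less_imp_le\<close>)
  moreover have "(\<integral>r. green a b r \<partial>lborel) = 1"
    using green_exp_moment[OF ab(1,2), of 0] ab by (simp add: has_bochner_integral_iff)
  ultimately show "emeasure resolvent (space resolvent) = 1"
    using green_measurable[OF ab(1,2)] by (simp add: resolvent_def emeasure_density)
qed

lemma wave_measure_integral:
  fixes f :: "real \<Rightarrow> real"
  assumes [measurable]: "f \<in> borel_measurable borel"
  shows "integrable wave_measure f \<longleftrightarrow> integrable (resolvent \<Otimes>\<^sub>M jump) (\<lambda>z. f (fst z + snd z + c * h))"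
    and "(\<integral>x. f x \<partial>wave_measure) = (\<integral>z. f (fst z + snd z + c * h) \<partial>(resolvent \<Otimes>\<^sub>M jump))"
  unfolding wave_measure_def by (simp_all add: integrable_distr_eq integral_distr)

lemma pair: "pair_sigma_finite resolvent jump"
  using prob_space_resolvent prob_space_jump
  by (simp add: pair_sigma_finite_def prob_space_imp_sigma_finite)

lemma prob_space_wave_measure: "prob_space wave_measure"
  unfolding wave_measure_def
  by (rule prob_space.prob_space_distr[OF prob_space_pair[OF prob_space_resolvent prob_space_jump]]) measurable

text \<open>Exponential moments of independent summands multiply: delay, jump and Green variable
  contribute one factor each.\<close>

lemma wave_measure_exp:
  assumes "- a < \<nu>" "\<nu> < b"
  shows "integrable wave_measure (\<lambda>x. exp (- \<nu> * x))"
    and "(\<integral>x. exp (- \<nu> * x) \<partial>wave_measure) = exp (- (\<nu> * c * h)) * transform \<nu> / ((a + \<nu>) * (b - \<nu>))"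
proof -
  interpret pair_sigma_finite resolvent jump by (rule pair)
  have eq: "exp (- \<nu> * (fst z + snd z + c * h)) = exp (- (\<nu> * c * h)) * (exp (- \<nu> * fst z) * exp (- \<nu> * snd z))" for z
    by (simp add: algebra_simps flip: exp_add)
  have int: "integrable (resolvent \<Otimes>\<^sub>M jump) (\<lambda>z. exp (- \<nu> * fst z) * exp (- \<nu> * snd z))"
  proof (rule Fubini_integrable)
    show "integrable resolvent (\<lambda>x. \<integral>y. norm (exp (- \<nu> * fst (x, y)) * exp (- \<nu> * snd (x, y))) \<partial>jump)"
      using resolvent_exp(1)[OF assms] by simp
  qed (use jump_exp(1)[of \<nu>] in auto)
  show "integrable wave_measure (\<lambda>x. exp (- \<nu> * x))"
    using integrable_mult_right[OF int, of "exp (- (\<nu> * c * h))"]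
    by (subst wave_measure_integral) (simp, simp only: eq)
  have "(\<integral>z. exp (- \<nu> * fst z) * exp (- \<nu> * snd z) \<partial>(resolvent \<Otimes>\<^sub>M jump)) = 1 / ((a + \<nu>) * (b - \<nu>)) * transform \<nu>"
    unfolding integral_fst'[OF int, symmetric]
    using resolvent_exp[OF assms] jump_exp[of \<nu>] by simp
  hence "(\<integral>z. exp (- \<nu> * (fst z + snd z + c * h)) \<partial>(resolvent \<Otimes>\<^sub>M jump))
      = exp (- (\<nu> * c * h)) * transform \<nu> / ((a + \<nu>) * (b - \<nu>))"
    unfolding eq by simp
  thus "(\<integral>x. exp (- \<nu> * x) \<partial>wave_measure) = exp (- (\<nu> * c * h)) * transform \<nu> / ((a + \<nu>) * (b - \<nu>))"
    by (subst wave_measure_integral) simp_all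
qed

text \<open>|y| \<le> exp(y) + exp(- y) at y = \<mu> x, where \<mu> < min(a, b) makes both
  exponential moments finite.\<close>

lemma wave_measure_first_moment: "integrable wave_measure (\<lambda>x. x)"
proof (rule Bochner_Integration.integrable_bound)
  define \<mu> where "\<mu> = min a b / 2"
  have \<mu>: "0 < \<mu>" "\<mu> < a" "\<mu> < b" using ab by (auto simp: \<mu>_def min_def)
  show "integrable wave_measure (\<lambda>x. (exp (- \<mu> * x) + exp (- (- \<mu>) * x)) / \<mu>)"
    using \<mu> ab by (intro integrable_divide Bochner_Integration.integrable_add wave_measure_exp) auto
  show "AE x in wave_measure. norm x \<le> norm ((exp (- \<mu> * x) + exp (- (- \<mu>) * x)) / \<mu>)"
  proof (intro AE_I2)
    fix x :: real
    have "\<bar>y\<bar> \<le> exp (- y) + exp y" for y :: real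
      using exp_ge_add_one_self[of y] exp_ge_add_one_self[of "- y"] exp_gt_zero[of y] exp_gt_zero[of "- y"]
      by linarith
    from this[of "\<mu> * x"] have "\<mu> * \<bar>x\<bar> \<le> exp (- \<mu> * x) + exp (- (- \<mu>) * x)"
      using \<mu> by (simp add: abs_mult)
    hence "\<bar>x\<bar> \<le> (exp (- \<mu> * x) + exp (- (- \<mu>) * x)) / \<mu>" using \<mu> by (simp add: field_simps)
    thus "norm x \<le> norm ((exp (- \<mu> * x) + exp (- (- \<mu>) * x)) / \<mu>)" using \<mu>(1) by simp
  qed
qed (simp add: wave_measure_def)

text \<open>Integrating over the jump first, with the delay included, produces the nonlocal term
  \<open>G\<close> of the profile equation. What is left is a convolution with \<open>green\<close>,
  which connects \<open>N\<close> to the differential equation.\<close>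

lemma wave_measure_conv:
  assumes v [measurable]: "v \<in> borel_measurable borel" and nonneg: "\<And>x. 0 \<le> v x" and B: "\<And>x. v x \<le> B"
  defines "G \<equiv> \<lambda>y. \<integral>w. K w * v (y - c * h - w) \<partial>lebesgue"
  shows "G \<in> borel_measurable borel" "\<And>y. 0 \<le> G y" "\<And>y. G y \<le> B"
    "(\<integral>x. v (t - x) \<partial>wave_measure) = (\<integral>r. green a b r * G (t - r) \<partial>lborel)"
proof -
  interpret J: prob_space jump by (rule prob_space_jump)
  interpret pair_sigma_finite resolvent jump by (rule pair)
  have G: "G y = (\<integral>w. v (y - c * h - w) \<partial>jump)" for y
    unfolding G_def by (subst jump_integral) auto
  show Gm: "G \<in> borel_measurable borel" unfolding G[abs_def] by measurable
  have i: "integrable jump (\<lambda>w. v (y - c * h - w))" for y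
    by (rule J.integrable_const_bound[of _ B]) (use nonneg B in auto)
  show "0 \<le> G y" for y unfolding G by (intro Bochner_Integration.integral_nonneg nonneg)
  show "G y \<le> B" for y unfolding G by (rule J.integral_le_const[OF i]) (simp add: B)
  have "finite_measure (resolvent \<Otimes>\<^sub>M jump)"
    using prob_space_pair[OF prob_space_resolvent prob_space_jump] by (simp add: prob_space_def)
  hence int: "integrable (resolvent \<Otimes>\<^sub>M jump) (\<lambda>z. v (t - (fst z + snd z + c * h)))"
    by (rule finite_measure.integrable_const_bound[of _ _ B]) (use nonneg B in auto)
  have "(\<integral>x. v (t - x) \<partial>wave_measure) = (\<integral>z. v (t - (fst z + snd z + c * h)) \<partial>(resolvent \<Otimes>\<^sub>M jump))"
    by (subst wave_measure_integral) auto
  also have "\<dots> = (\<integral>r. G (t - r) \<partial>resolvent)"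
    unfolding integral_fst'[OF int, symmetric] G by (simp add: algebra_simps)
  also have "\<dots> = (\<integral>r. green a b r * G (t - r) \<partial>lborel)"
    by (rule resolvent_integral) (use Gm in measurable)
  finally show "(\<integral>x. v (t - x) \<partial>wave_measure) = (\<integral>r. green a b r * G (t - r) \<partial>lborel)" .
qed

text \<open>After the convolution is written with the factor green(t - y) G(y), the Harnack
  inequality of \<open>green\<close> passes under the integral because \<open>G\<close> is
  nonnegative.\<close>

lemma wave_kernel_wave_measure: "wave_kernel wave_measure (a + b)"
proof (intro wave_kernel.intro wave_kernel_axioms.intro)
  show "sets wave_measure = sets borel" by (simp add: wave_measure_def)
  show "0 \<le> a + b" using ab by simp
  fix v :: "real \<Rightarrow> real" and B s t
  assume v: "v \<in> borel_measurable borel" "\<And>x. 0 \<le> v x" "\<And>x. v x \<le> B"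
  define G where "G y = (\<integral>w. K w * v (y - c * h - w) \<partial>lebesgue)" for y
  note G = wave_measure_conv[OF v, folded G_def]
  have eq: "(\<integral>x. v (t - x) \<partial>wave_measure) = (\<integral>y. green a b (t - y) * G y \<partial>lborel)" for t
    using G(4)[of t] green_conv_commute[OF ab(1,2), of G t] by simp
  have B: "\<bar>G y\<bar> \<le> B" for y using G(2,3)[of y] by simp
  note int = green_mult_integrable[OF ab(1,2) G(1) B]
  have "(\<integral>y. exp (- (a + b) * \<bar>t - s\<bar>) * (green a b (t - y) * G y) \<partial>lborel) \<le> (\<integral>y. green a b (s - y) * G y \<partial>lborel)"
  proof (rule integral_mono)
    show "exp (- (a + b) * \<bar>t - s\<bar>) * (green a b (t - y) * G y) \<le> green a b (s - y) * G y" for y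
      using mult_right_mono[OF green_harnack[OF ab(1,2), of "s - t" "t - y"] G(2)[of y]]
      by (simp add: abs_minus_commute mult.assoc)
  qed (use int in auto)
  thus "exp (- (a + b) * \<bar>t - s\<bar>) * (\<integral>x. v (t - x) \<partial>wave_measure) \<le> (\<integral>x. v (s - x) \<partial>wave_measure)"
    unfolding eq by simp
qed (use prob_space_wave_measure wave_measure_first_moment in auto)

end

end

section \<open>Semi-wavefronts\<close>

lemma continuous_jump_conv:
  fixes K v :: "real \<Rightarrow> real"
  assumes K: "integrable lebesgue K" and v: "continuous_on UNIV v" "\<And>x. \<bar>v x\<bar> \<le> B"
  shows "continuous_on UNIV (\<lambda>y. \<integral>w. K w * v (y - d - w) \<partial>lebesgue)"
    and "integrable lebesgue (\<lambda>w. K w * v (y - d - w))"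
proof -
  have m: "(\<lambda>w. v (y - d - w)) \<in> borel_measurable lebesgue" for y
  proof -
    have "continuous_on UNIV (\<lambda>w. v (y - d - w))"
      by (rule continuous_on_compose2[OF v(1)]) (auto intro!: continuous_intros)
    hence "(\<lambda>w. v (y - d - w)) \<in> borel_measurable borel" by (rule borel_measurable_continuous_onI)
    thus ?thesis by (intro measurable_completion) simp
  qed
  have Km: "K \<in> borel_measurable lebesgue" using K by (rule borel_measurable_integrable)
  have bound: "norm (K w * v x) \<le> \<bar>K w\<bar> * B" for w x
    using mult_left_mono[OF v(2)[of x], of "\<bar>K w\<bar>"] by (simp add: abs_mult)
  have iB: "integrable lebesgue (\<lambda>w. \<bar>K w\<bar> * B)" using K by auto
  have B: "0 \<le> B" using v(2)[of 0] by simp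
  show "integrable lebesgue (\<lambda>w. K w * v (y - d - w))"
    by (rule Bochner_Integration.integrable_bound[OF iB])
       (use bound m Km B in \<open>auto intro!: borel_measurable_times simp: abs_mult\<close>)
  show "continuous_on UNIV (\<lambda>y. \<integral>w. K w * v (y - d - w) \<partial>lebesgue)"
    unfolding continuous_on_sequentially comp_def
  proof (intro allI ballI impI, elim conjE)
    fix X :: "nat \<Rightarrow> real" and y :: real assume X: "X \<longlonglongrightarrow> y"
    show "(\<lambda>n. \<integral>w. K w * v (X n - d - w) \<partial>lebesgue) \<longlonglongrightarrow> (\<integral>w. K w * v (y - d - w) \<partial>lebesgue)"
    proof (rule integral_dominated_convergence[OF _ _ iB])
      show "AE w in lebesgue. (\<lambda>n. K w * v (X n - d - w)) \<longlonglongrightarrow> K w * v (y - d - w)"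
        using v(1) by (intro AE_I2 tendsto_intros isCont_tendsto_compose[where g = v] X)
          (simp add: continuous_on_eq_continuous_at)
    qed (use bound m Km in \<open>auto intro!: borel_measurable_times\<close>)
  qed
qed

lemma classical_solution_of_profile:
  fixes \<phi> g K :: "real \<Rightarrow> real"
  assumes d1: "\<And>t. (\<phi> has_real_derivative \<phi>' t) (at t)" and d2: "\<And>t. (\<phi>' has_real_derivative \<phi>'' t) (at t)"
    and cont: "continuous_on UNIV \<phi>'" "continuous_on UNIV \<phi>''"
    and int: "\<And>y. integrable lebesgue (\<lambda>w. K w * g (\<phi> (y - c * h - w)))"
    and eq: "\<And>t. \<phi>'' t - c * \<phi>' t - \<phi> t + (\<integral>w. K w * g (\<phi> (t - c * h - w)) \<partial>lebesgue) = 0"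
  shows "classical_solution h K g (\<lambda>t x. \<phi> (x + c * t))"
proof -
  have cont0: "continuous_on UNIV \<phi>"
    using d1 by (auto intro!: DERIV_isCont continuous_at_imp_continuous_on)
  have joint: "continuous_on UNIV (\<lambda>(t, x). f (x + c * t))" if "continuous_on UNIV f" for f :: "real \<Rightarrow> real"
    unfolding case_prod_beta by (rule continuous_on_compose2[OF that]) (auto intro!: continuous_intros)
  have dt: "((\<lambda>t'. \<phi> (x + c * t')) has_real_derivative c * \<phi>' (x + c * t)) (at t)" for t x
    by (rule DERIV_cong[OF DERIV_chain2[OF d1]]) (auto intro!: derivative_eq_intros)
  have dx: "((\<lambda>x'. f (x' + c * t)) has_real_derivative f' (x + c * t)) (at x)"
    if "\<And>t. (f has_real_derivative f' t) (at t)" for f f' t x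
    by (rule DERIV_cong[OF DERIV_chain2[OF that]]) (auto intro!: derivative_eq_intros)
  \<comment> \<open>The substitution y = x - w turns the nonlocal term of the equation into that of
    the profile.\<close>
  have reflect: "(\<lambda>w. K (x - (x + (- 1) * w)) * g (\<phi> (x + (- 1) * w + c * (t - h)))) = (\<lambda>w. K w * g (\<phi> (x + c * t - c * h - w)))" for t x
    by (intro ext) (simp add: algebra_simps)
  have nonlocal: "integrable lebesgue (\<lambda>y. K (x - y) * g (\<phi> (y + c * (t - h))))"
    "(\<integral>y. K (x - y) * g (\<phi> (y + c * (t - h))) \<partial>lebesgue) = (\<integral>w. K w * g (\<phi> (x + c * t - c * h - w)) \<partial>lebesgue)" for t x
    using int[of "x + c * t"] lebesgue_integrable_real_affine_iff[of "-1" "\<lambda>y. K (x - y) * g (\<phi> (y + c * (t - h)))" x]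
      lebesgue_integral_real_affine[of "-1" "\<lambda>y. K (x - y) * g (\<phi> (y + c * (t - h)))" x]
    unfolding reflect by simp_all
  show ?thesis
    unfolding classical_solution_def
  proof (intro exI conjI allI)
    show "((\<lambda>t'. \<phi> (x + c * t')) has_real_derivative (\<lambda>t x. c * \<phi>' (x + c * t)) t x) (at t)" for t x by (rule dt)
    show "((\<lambda>x'. \<phi> (x' + c * t)) has_real_derivative (\<lambda>t x. \<phi>' (x + c * t)) t x) (at x)" for t x by (rule dx[OF d1])
    show "((\<lambda>x'. (\<lambda>t x. \<phi>' (x + c * t)) t x') has_real_derivative (\<lambda>t x. \<phi>'' (x + c * t)) t x) (at x)" for t x by (rule dx[OF d2])
    show "(\<lambda>t x. c * \<phi>' (x + c * t)) t x = (\<lambda>t x. \<phi>'' (x + c * t)) t x - \<phi> (x + c * t) +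
        (\<integral>y. K (x - y) * g (\<phi> (y + c * (t - h))) \<partial>lebesgue)" for t x
      using eq[of "x + c * t"] unfolding nonlocal(2) by simp
    show "continuous_on UNIV (\<lambda>(t, x). c * \<phi>' (x + c * t))"
      by (rule joint) (intro continuous_intros cont)
  qed (use joint cont cont0 nonlocal(1) in auto)
qed

lemma (in characteristic) wavefront_exists:
  fixes g :: "real \<Rightarrow> real"
  assumes q: "q = 1" and c: "0 < c" "0 < \<nu>" "char_fun \<nu> c \<le> 0"
    and g: "continuous_on UNIV g" "\<And>s. 0 \<le> g s" "\<And>s. g s \<le> B" "\<And>s. 0 \<le> s \<Longrightarrow> g s \<le> p * s"
    and \<delta>: "0 < \<delta>" "\<And>s. 0 < s \<Longrightarrow> s \<le> \<delta> \<Longrightarrow> s < g s"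
  obtains \<phi> where "semi_wavefront h K g c \<phi>" "\<And>s. \<phi> s \<le> B"
proof -
  \<comment> \<open>\<open>- a\<close> and \<open>b\<close> are the roots of z^2 - c z - 1, the
    characteristic polynomial of \<phi>'' - c \<phi>' - \<phi>.\<close>
  define r where "r = sqrt (c\<^sup>2 + 4)"
  define a where "a = (r - c) / 2"
  define b where "b = (r + c) / 2"
  have r2: "r * r = c * c + 4" unfolding r_def using c by (simp add: power2_eq_square)
  have "c < r" unfolding r_def using c by (intro real_less_rsqrt) simp
  hence ab: "0 < a" "0 < b" "a * b = 1" "b - a = c"
    using c r2 by (auto simp: a_def b_def field_simps)
  have ab': "(a + \<nu>) * (b - \<nu>) = 1 + c * \<nu> - \<nu>\<^sup>2"
    using ab(3) by (simp add: ab(4)[symmetric] power2_eq_square algebra_simps)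
  have cf: "p * (exp (- (\<nu> * c * h)) * transform \<nu>) \<le> (a + \<nu>) * (b - \<nu>)"
    using c(3) q unfolding ab' char_fun_def by linarith
  have "0 < p * (exp (- (\<nu> * c * h)) * transform \<nu>)" using p_pos transform_pos by simp
  hence pos: "0 < (a + \<nu>) * (b - \<nu>)" using cf by linarith
  \<comment> \<open>The first factor of the positive product is positive, hence so is the second;
    this puts \<nu> where the exponential moment of \<open>N\<close> is finite.\<close>
  hence \<nu>b: "\<nu> < b" using ab c by (simp add: zero_less_mult_iff)
  define N where "N = wave_measure a b c"
  interpret wave_kernel N "a + b"
    unfolding N_def by (rule wave_kernel_wave_measure[OF ab(1-3)])
  interpret wave_equation N "a + b" g p B \<delta> \<nu>
  proof (unfold_locales)
    show "integrable N (\<lambda>x. exp (- \<nu> * x))"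
      unfolding N_def using ab c \<nu>b by (intro wave_measure_exp) auto
    have "expectation (\<lambda>x. exp (- \<nu> * x)) = exp (- (\<nu> * c * h)) * transform \<nu> / ((a + \<nu>) * (b - \<nu>))"
      unfolding N_def using ab c \<nu>b by (intro wave_measure_exp) auto
    thus "p * expectation (\<lambda>x. exp (- \<nu> * x)) \<le> 1" using cf pos by (simp add: divide_le_eq)
  qed (use g \<delta> c in auto)
  obtain \<phi> where lip: "\<And>s t. \<bar>\<phi> s - \<phi> t\<bar> \<le> (a + b) * B * \<bar>s - t\<bar>" and range: "\<And>s. 0 \<le> \<phi> s" "\<And>s. \<phi> s \<le> B"
    and fp: "\<And>s. \<phi> s = conv (\<lambda>s. g (\<phi> s)) s" and le: "\<And>s. s < 0 \<Longrightarrow> \<phi> s \<le> \<delta>" and ge: "\<delta> \<le> \<phi> 0"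
    using limit_solution by blast
  have lim: "(\<phi> \<longlongrightarrow> 0) at_bot" by (rule vanishing_at_bot[OF lip range fp le])
  have cont: "continuous_on UNIV \<phi>" by (rule lipschitz_continuous, rule lip)
  have cont_g: "continuous_on UNIV (\<lambda>s. g (\<phi> s))"
    by (rule continuous_on_compose2[OF g(1) cont]) auto
  have abs_g: "\<bar>g (\<phi> s)\<bar> \<le> B" for s using g(2,3)[of "\<phi> s"] by simp
  have meas: "\<phi> \<in> borel_measurable borel" by (rule borel_measurable_continuous_onI[OF cont])
  note cg = compose_g[OF meas]
  \<comment> \<open>The Harnack inequality spreads \<phi>(0) \<ge> \<delta> to every point.\<close>
  have pos: "0 < \<phi> t" for t
  proof -
    have "0 < exp (- (a + b) * \<bar>0 - t\<bar>) * \<phi> 0" using ge \<delta> by simp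
    also have "\<dots> \<le> \<phi> t" unfolding fp[of 0] fp[of t] conv_def by (rule harnack[OF cg])
    finally show ?thesis .
  qed
  define G where "G y = (\<integral>w. K w * g (\<phi> (y - c * h - w)) \<partial>lebesgue)" for y
  have G_cont: "continuous_on UNIV G"
    unfolding G_def by (rule continuous_jump_conv(1)[OF K_integrable cont_g abs_g])
  note conv_green = wave_measure_conv[OF ab(1-3) cg, where c = c, folded G_def N_def]
  have G_abs: "\<bar>G y\<bar> \<le> B" for y using conv_green(2,3)[of y] by simp
  have "\<phi> t = (\<integral>r. green a b r * G (t - r) \<partial>lborel)" for t
    unfolding fp[of t] conv_def by (rule conv_green(4))
  from green_differential_equation[OF ab(1-3) G_cont G_abs this, unfolded ab(4)]
  obtain \<phi>' \<phi>'' where d: "\<And>t. (\<phi> has_real_derivative \<phi>' t) (at t)"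
    "\<And>t. (\<phi>' has_real_derivative \<phi>'' t) (at t)"
    "continuous_on UNIV \<phi>'" "continuous_on UNIV \<phi>''"
    "\<And>t. \<phi>'' t - c * \<phi>' t - \<phi> t + G t = 0" by blast
  have "classical_solution h K g (\<lambda>t x. \<phi> (x + c * t))"
    by (rule classical_solution_of_profile[OF d(1-4)])
       (use continuous_jump_conv(2)[OF K_integrable cont_g abs_g] d(5) in \<open>simp_all add: G_def\<close>)
  moreover have "bounded (range \<phi>)"
    using range by (auto intro!: boundedI[of _ B])
  ultimately show thesis using that[of \<phi>] pos lim range by (simp add: semi_wavefront_def)
qed

theorem theorem4:
  fixes h \<zeta>\<^sub>1 \<zeta>\<^sub>2 \<kappa> c :: real and K g :: "real \<Rightarrow> real"
  assumes "0 \<le> h"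
    and "\<And>s. 0 \<le> K s"
    and "\<And>\<mu>::real. integrable lebesgue (\<lambda>s. K s * exp (\<mu> * s))"
    and "(\<integral>s. K s \<partial>lebesgue) = 1"
    and "continuous_on {0..} g"
    and "g ` {0..} \<subseteq> {0..}"
    and "\<And>s. 0 < s \<Longrightarrow> 0 < g s"
    and "0 < \<zeta>\<^sub>1" and "\<zeta>\<^sub>1 < \<zeta>\<^sub>2"
    and "g ` {\<zeta>\<^sub>1..\<zeta>\<^sub>2} \<subseteq> {\<zeta>\<^sub>1..\<zeta>\<^sub>2}"
    and "g ` {0..\<zeta>\<^sub>1} \<subseteq> {0..\<zeta>\<^sub>2}"
    and "\<And>s. s \<in> {\<zeta>\<^sub>1..\<zeta>\<^sub>2} \<Longrightarrow> g \<zeta>\<^sub>1 \<le> g s"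
    and "\<And>s. s \<in> {0<..\<zeta>\<^sub>1} \<Longrightarrow> s < g s"
    and "\<kappa> \<noteq> 0" and "{s. 0 \<le> s \<and> g s = s} = {0, \<kappa>}"
    and "bdd_above ((\<lambda>s. g s / s) ` {0<..})"
    and "0 < c"
    and "inv_sqrt_ereal (eps0 K h (SUP s\<in>{0<..}. g s / s) 1) \<le> c"
  shows "\<exists>\<phi>. semi_wavefront h K g c \<phi>"
proof -
  define p where "p = (SUP s\<in>{0<..}. g s / s)"
  \<comment> \<open>Clamping the argument to \<open>[0, \<zeta>\<^sub>2]\<close>, which
    \<open>g\<close> maps into itself, gives a nonlinearity on the whole line with values in the
    same interval. A wave for \<open>G\<close> stays below \<open>\<zeta>\<^sub>2\<close>, where
    \<open>G\<close> and \<open>g\<close> agree, and so solves the original equation.\<close>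
  define G where "G s = g (min \<zeta>\<^sub>2 (max 0 s))" for s
  have le_p: "g s \<le> p * s" if "0 < s" for s
  proof -
    have "g s / s \<le> p" unfolding p_def by (rule cSUP_upper) (use assms(16) that in auto)
    thus ?thesis using that by (simp add: field_simps)
  qed
  \<comment> \<open>The gap at \<open>\<zeta>\<^sub>1\<close> yields p > 1 = q, the range in which
    the thresholds are defined.\<close>
  have "\<zeta>\<^sub>1 < g \<zeta>\<^sub>1" using assms(8,13) by simp
  also have "\<dots> \<le> p * \<zeta>\<^sub>1" by (rule le_p[OF assms(8)])
  finally have p: "1 < p" using assms(8) by simp
  have g0: "g 0 = 0" using assms(15) by auto
  interpret characteristic K h p 1
    by unfold_locales (use assms(1-4) p in auto)
  obtain \<nu> where \<nu>: "0 < \<nu>" "char_fun \<nu> c \<le> 0"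
    using speed_condition[OF assms(17)] assms(18) unfolding p_def by blast
  have G_eq: "G s = g s" if "0 \<le> s" "s \<le> \<zeta>\<^sub>2" for s using that by (simp add: G_def)
  have G_cont: "continuous_on UNIV G"
    unfolding G_def
    by (rule continuous_on_compose2[OF assms(5)]) (use assms(8,9) in \<open>auto intro!: continuous_intros\<close>)
  have G_range: "0 \<le> G s" "G s \<le> \<zeta>\<^sub>2" for s
  proof -
    define y where "y = min \<zeta>\<^sub>2 (max 0 s)"
    have y: "0 \<le> y" "y \<le> \<zeta>\<^sub>2" using assms(8,9) by (auto simp: y_def)
    show "0 \<le> G s" using assms(6) y by (auto simp: G_def y_def[symmetric])
    show "G s \<le> \<zeta>\<^sub>2" using assms(10,11) y by (cases "y \<le> \<zeta>\<^sub>1") (auto simp: G_def y_def[symmetric] image_subset_iff)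
  qed
  have G_le: "G s \<le> p * s" if "0 \<le> s" for s
  proof (cases "s = 0")
    case False
    have "G s \<le> p * min \<zeta>\<^sub>2 s" using le_p[of "min \<zeta>\<^sub>2 s"] False that assms(8,9) by (simp add: G_def)
    also have "\<dots> \<le> p * s" using p by (intro mult_left_mono) auto
    finally show ?thesis .
  qed (use g0 assms(8,9) in \<open>simp add: G_def\<close>)
  have G_gt: "s < G s" if "0 < s" "s \<le> \<zeta>\<^sub>1" for s
    using assms(13)[of s] G_eq[of s] that assms(9) by simp
  obtain \<phi> where \<phi>: "semi_wavefront h K G c \<phi>" "\<And>s. \<phi> s \<le> \<zeta>\<^sub>2"
    using wavefront_exists[OF refl assms(17) \<nu> G_cont G_range G_le assms(8) G_gt] by blast
  have "G (\<phi> s) = g (\<phi> s)" for s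
    using \<phi> by (intro G_eq) (auto simp: semi_wavefront_def less_imp_le)
  hence "semi_wavefront h K g c \<phi>"
    using \<phi>(1) by (simp add: semi_wavefront_def classical_solution_def)
  thus ?thesis by blast
qed

end
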